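(* Let $p\geq 2$ and let $d_1,\ldots,d_p$ be positive integers. The maximum dimension of an NPT subspace of $\mathbb{C}^{d_1}\otimes\cdots\otimes\mathbb{C}^{d_p}$ is exactly \[ d_1d_2\cdots d_p - d_1-d_2-\cdots-d_p+p-1. \]
   Context: $M_d$ is the set of $d\times d$ complex matrices. A density matrix is a positive semidefinite matrix with trace $1$, and its support $\mathrm{supp}(\rho)$ is its range. For $A\subseteq\{1,\ldots,p\}$, the partial transpose on the subsystems in $A$ is the linear map on $M_{d_1}\otimes\cdots\otimes M_{d_p}$ acting as the transpose on the tensor factors indexed by $A$ and as the identity on the others. A subspace $\mathcal{S}\subseteq\mathbb{C}^{d_1}\otimes\cdots\otimes\mathbb{C}^{d_p}$ is an NPT subspace if for every density matrix $\rho\in M_{d_1}\otimes\cdots\otimes M_{d_p}$ with $\mathrm{supp}(\rho)\subseteq\mathcal{S}$ there is some $A\subseteq\{1,\ldots,p\}$ such that the partial transpose of $\rho$ on the subsystems in $A$ is not positive semidefinite. *)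

theory Defs
  imports Complex_Main "HOL-Library.FuncSet" "HOL-Library.Function_Algebras"
begin

text \<open>
  Vectors and matrices are functions on a type of indices that vanish outside a finite
  index set \<open>I\<close>; thus the spaces are those of \<open>\<complex>\<^sup>I\<close> and \<open>\<complex>\<^bsup>I \<times> I\<^esup>\<close>.
\<close>

definition cscale :: "complex \<Rightarrow> ('i \<Rightarrow> complex) \<Rightarrow> 'i \<Rightarrow> complex" where
  "cscale c v = (\<lambda>x. c * v x)"

global_interpretation cvec: vector_space cscale
  by unfold_locales (auto simp: cscale_def fun_eq_iff algebra_simps)

definition vecs :: "'i set \<Rightarrow> ('i \<Rightarrow> complex) set" where
  "vecs I = {v. \<forall>x. x \<notin> I \<longrightarrow> v x = 0}"

definition mats :: "'i set \<Rightarrow> ('i \<Rightarrow> 'i \<Rightarrow> complex) set" where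
  "mats I = {M. \<forall>x y. x \<notin> I \<or> y \<notin> I \<longrightarrow> M x y = 0}"

definition mat_vec :: "'i set \<Rightarrow> ('i \<Rightarrow> 'i \<Rightarrow> complex) \<Rightarrow> ('i \<Rightarrow> complex) \<Rightarrow> 'i \<Rightarrow> complex" where
  "mat_vec I M v = (\<lambda>x. \<Sum>y\<in>I. M x y * v y)"

definition mat_trace :: "'i set \<Rightarrow> ('i \<Rightarrow> 'i \<Rightarrow> complex) \<Rightarrow> complex" where
  "mat_trace I M = (\<Sum>x\<in>I. M x x)"

definition hermitian :: "'i set \<Rightarrow> ('i \<Rightarrow> 'i \<Rightarrow> complex) \<Rightarrow> bool" where
  "hermitian I M \<longleftrightarrow> (\<forall>x\<in>I. \<forall>y\<in>I. M x y = cnj (M y x))"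

definition pos_semidef :: "'i set \<Rightarrow> ('i \<Rightarrow> 'i \<Rightarrow> complex) \<Rightarrow> bool" where
  "pos_semidef I M \<longleftrightarrow> hermitian I M \<and>
     (\<forall>v\<in>vecs I. 0 \<le> Re (\<Sum>x\<in>I. cnj (v x) * mat_vec I M v x))"

definition density_matrix :: "'i set \<Rightarrow> ('i \<Rightarrow> 'i \<Rightarrow> complex) \<Rightarrow> bool" where
  "density_matrix I \<rho> \<longleftrightarrow> \<rho> \<in> mats I \<and> pos_semidef I \<rho> \<and> mat_trace I \<rho> = 1"

definition supp :: "'i set \<Rightarrow> ('i \<Rightarrow> 'i \<Rightarrow> complex) \<Rightarrow> ('i \<Rightarrow> complex) set" where
  "supp I \<rho> = mat_vec I \<rho> ` vecs I"

text \<open>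
  \<open>\<complex>\<^bsup>d 1\<^esup> \<otimes> \<dots> \<otimes> \<complex>\<^bsup>d p\<^esup>\<close> is \<open>vecs (multi_indices p d)\<close>, and
  the matrices on it are \<open>mats (multi_indices p d)\<close>: the coordinates are taken with respect
  to the tensor products of the standard basis vectors, the basis of the \<open>k\<close>-th factor being
  numbered \<open>0, \<dots>, d k - 1\<close>.
\<close>

definition multi_indices :: "nat \<Rightarrow> (nat \<Rightarrow> nat) \<Rightarrow> (nat \<Rightarrow> nat) set" where
  "multi_indices p d = (\<Pi>\<^sub>E k\<in>{1..p}. {..<d k})"

text \<open>Partial transposition exchanges the row and the column index of the factors in \<open>A\<close>.\<close>

definition partial_transpose ::
    "nat set \<Rightarrow> ((nat \<Rightarrow> nat) \<Rightarrow> (nat \<Rightarrow> nat) \<Rightarrow> complex) \<Rightarrow> (nat \<Rightarrow> nat) \<Rightarrow> (nat \<Rightarrow> nat) \<Rightarrow> complex" where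
  "partial_transpose A M = (\<lambda>x y. M (override_on x y A) (override_on y x A))"

definition npt_subspace :: "nat \<Rightarrow> (nat \<Rightarrow> nat) \<Rightarrow> ((nat \<Rightarrow> nat) \<Rightarrow> complex) set \<Rightarrow> bool" where
  "npt_subspace p d S \<longleftrightarrow>
     cvec.subspace S \<and> S \<subseteq> vecs (multi_indices p d) \<and>
     (\<forall>\<rho>. density_matrix (multi_indices p d) \<rho> \<and> supp (multi_indices p d) \<rho> \<subseteq> S \<longrightarrow>
        (\<exists>A\<subseteq>{1..p}. \<not> pos_semidef (multi_indices p d) (partial_transpose A \<rho>)))"

text \<open>
  The lemmas below confirm that \<open>partial_transpose A\<close> is the linear map on the matrix space that
  transposes the factors in \<open>A\<close> of an elementary tensor \<open>X 1 \<otimes> \<dots> \<otimes> X p\<close>.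
\<close>

definition tensor_mat ::
    "nat \<Rightarrow> (nat \<Rightarrow> nat) \<Rightarrow> (nat \<Rightarrow> nat \<Rightarrow> nat \<Rightarrow> complex) \<Rightarrow> (nat \<Rightarrow> nat) \<Rightarrow> (nat \<Rightarrow> nat) \<Rightarrow> complex" where
  "tensor_mat p d X = (\<lambda>x y. if x \<in> multi_indices p d \<and> y \<in> multi_indices p d
     then \<Prod>k=1..p. X k (x k) (y k) else 0)"

lemma override_on_multi_indices_iff:
  assumes "A \<subseteq> {1..p}"
  shows "override_on x y A \<in> multi_indices p d \<and> override_on y x A \<in> multi_indices p d
    \<longleftrightarrow> x \<in> multi_indices p d \<and> y \<in> multi_indices p d"
proof -
  have *: "z \<in> multi_indices p d \<longleftrightarrow> (\<forall>k. if k \<in> {1..p} then z k < d k else z k = undefined)" for z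
    by (auto simp: multi_indices_def PiE_iff extensional_def)
  have "(if k \<in> {1..p} then override_on x y A k < d k else override_on x y A k = undefined) \<and>
        (if k \<in> {1..p} then override_on y x A k < d k else override_on y x A k = undefined) \<longleftrightarrow>
        (if k \<in> {1..p} then x k < d k else x k = undefined) \<and>
        (if k \<in> {1..p} then y k < d k else y k = undefined)" for k
    using assms by (cases "k \<in> A") (auto simp: override_on_def)
  then show ?thesis unfolding * by blast
qed

lemma partial_transpose_mats:
  assumes "A \<subseteq> {1..p}" "M \<in> mats (multi_indices p d)"
  shows "partial_transpose A M \<in> mats (multi_indices p d)"
  using override_on_multi_indices_iff[OF assms(1)] assms(2)
  unfolding mats_def partial_transpose_def by blast

lemma partial_transpose_linear:
  "partial_transpose A (\<lambda>x y. a * M x y + b * N x y)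
    = (\<lambda>x y. a * partial_transpose A M x y + b * partial_transpose A N x y)"
  by (simp add: partial_transpose_def)

lemma partial_transpose_tensor_mat:
  assumes "A \<subseteq> {1..p}"
  shows "partial_transpose A (tensor_mat p d X)
    = tensor_mat p d (\<lambda>k. if k \<in> A then (\<lambda>i j. X k j i) else X k)"
  unfolding partial_transpose_def tensor_mat_def override_on_multi_indices_iff[OF assms]
  by (intro ext if_cong refl prod.cong) (auto simp: override_on_def)

end

(* Lower bound: in the subspace of vectors whose coordinates sum to zero over each set of indices
   x with fixed x 1 + ... + x p, a state with positive partial transposes has zero diagonal, by
   induction on that sum: for distinct x, y with equal sum, a partial transpose moves the entry at
   (x, y) to (min x y, max x y), and min x y has a smaller sum. The remaining diagonal entries are
   column sums, hence zero.

   Upper bound: a subspace of larger dimension is cut out by at most n = (d 1 - 1) + ... + (d p - 1)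
   multilinear forms. The multihomogeneous polynomials of degree (m, ..., m) grow like m^n, too fast
   to be generated by the n forms together with finitely many polynomials, so in every degree some
   nonzero functional vanishes on the ideal of the forms. It is a vector in a tensor product of
   symmetric powers; its one-copy reduced states are supported in the subspace and, reordering
   creation and annihilation operators as in the quantum de Finetti theorem, their partial transposes
   are within O(1/m) of Gram matrices. A limit point is a state in the subspace all of whose partial
   transposes are positive semidefinite. *)

theory Submission
  imports Defs "HOL-Analysis.Analysis"
begin

subsection \<open>Dimension counting in spaces of finitely supported functions\<close>

lemma linear_cscale_iff:
  "Vector_Spaces.linear cscale cscale E \<longleftrightarrow>
    (\<forall>v w. E (v + w) = E v + E w) \<and> (\<forall>c v. E (cscale c v) = cscale c (E v))"
  by (simp add: Vector_Spaces.linear_iff cvec.vector_space_axioms)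

lemma subspace_vecs: "cvec.subspace (vecs I)"
  by (auto simp: cvec.subspace_def vecs_def cscale_def)

definition coord_vec :: "'i \<Rightarrow> 'i \<Rightarrow> complex" where
  "coord_vec x = (\<lambda>y. if y = x then 1 else 0)"

lemma coord_vec_in_vecs: "x \<in> I \<Longrightarrow> coord_vec x \<in> vecs I"
  by (auto simp: coord_vec_def vecs_def)

lemma inj_coord_vec: "inj coord_vec"
  by (rule injI) (metis coord_vec_def zero_neq_one)

lemma sum_fun_apply: "(\<Sum>i\<in>A. f i) x = (\<Sum>i\<in>A. f i x)"
  by (induction A rule: infinite_finite_induct) auto

lemma vecs_expand:
  assumes "finite I" "v \<in> vecs I"
  shows "v = (\<Sum>x\<in>I. cscale (v x) (coord_vec x))"
proof
  fix y
  have "(\<Sum>x\<in>I. cscale (v x) (coord_vec x)) y = (\<Sum>x\<in>I. if y = x then v x else 0)"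
    unfolding sum_fun_apply by (intro sum.cong) (auto simp: cscale_def coord_vec_def)
  also have "\<dots> = v y"
    using assms by (auto simp: vecs_def)
  finally show "v y = (\<Sum>x\<in>I. cscale (v x) (coord_vec x)) y" by simp
qed

lemma vecs_subset_span_coord_vec:
  assumes "finite I"
  shows "vecs I \<subseteq> cvec.span (coord_vec ` I)"
proof
  fix v assume "v \<in> vecs I"
  then have "v = (\<Sum>x\<in>I. cscale (v x) (coord_vec x))"
    by (rule vecs_expand[OF assms])
  also have "\<dots> \<in> cvec.span (coord_vec ` I)"
    by (intro cvec.span_sum cvec.span_scale cvec.span_base imageI)
  finally show "v \<in> cvec.span (coord_vec ` I)" .
qed

lemma independent_coord_vec:
  assumes "finite I"
  shows "cvec.independent (coord_vec ` I)"
proof (rule cvec.independent_if_scalars_zero)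
  fix f b assume 0: "(\<Sum>x\<in>coord_vec ` I. cscale (f x) x) = 0" and "b \<in> coord_vec ` I"
  then obtain y where y: "y \<in> I" "b = coord_vec y" by blast
  have "(\<Sum>x\<in>coord_vec ` I. cscale (f x) x) y = (\<Sum>x\<in>coord_vec ` I. f x * x y)"
    by (simp add: sum_fun_apply cscale_def)
  also have "\<dots> = (\<Sum>x\<in>I. f (coord_vec x) * coord_vec x y)"
    by (subst sum.reindex[OF inj_on_subset[OF inj_coord_vec subset_UNIV]]) (simp add: o_def)
  also have "\<dots> = (\<Sum>x\<in>I. if y = x then f (coord_vec x) else 0)"
    by (rule sum.cong[OF refl]) (subst (2) coord_vec_def, simp)
  also have "\<dots> = f b"
    using y assms by simp
  finally show "f b = 0"
    unfolding 0 zero_fun_apply by (rule sym)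
qed (use assms in auto)

lemma dim_vecs: "finite I \<Longrightarrow> cvec.dim (vecs I) = card I"
  by (rule cvec.dim_unique[OF _ vecs_subset_span_coord_vec independent_coord_vec])
    (auto simp: coord_vec_in_vecs card_image inj_on_subset[OF inj_coord_vec])

lemma finite_basis_exists:
  assumes "finite J" "V \<subseteq> vecs J"
  obtains B where "finite B" "B \<subseteq> V" "cvec.independent B" "V \<subseteq> cvec.span B" "card B = cvec.dim V"
proof -
  obtain B where B: "B \<subseteq> V" "cvec.independent B" "V \<subseteq> cvec.span B" "card B = cvec.dim V"
    using cvec.basis_exists by blast
  then have "finite B"
    using cvec.independent_span_bound[of "coord_vec ` J" B] vecs_subset_span_coord_vec assms by blast
  then show ?thesis using B that by blast
qed

lemma dim_mono_vecs:
  assumes "finite J" "V \<subseteq> W" "W \<subseteq> vecs J"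
  shows "cvec.dim V \<le> cvec.dim W"
proof -
  obtain B where "finite B" "W \<subseteq> cvec.span B" "card B = cvec.dim W"
    using finite_basis_exists assms by metis
  then show ?thesis
    using cvec.dim_le_card[of V B] assms by auto
qed

text \<open>A basis of the kernel together with preimages of a basis of the image spans
  \<open>W\<close>. This half of rank-nullity suffices for both bounds.\<close>

lemma dim_le_kernel_plus_image:
  assumes W: "cvec.subspace W" "W \<subseteq> vecs J" "finite J"
    and E: "Vector_Spaces.linear cscale cscale E"
    and EW: "E ` W \<subseteq> vecs J'" "finite J'"
  shows "cvec.dim W \<le> cvec.dim {w \<in> W. E w = 0} + cvec.dim (E ` W)"
proof -
  interpret E: Vector_Spaces.linear cscale cscale E by (rule E)
  obtain B where B: "finite B" "{w \<in> W. E w = 0} \<subseteq> cvec.span B" "card B = cvec.dim {w \<in> W. E w = 0}"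
    using finite_basis_exists[OF W(3), of "{w \<in> W. E w = 0}"] W(2) by (metis (no_types, lifting) mem_Collect_eq subset_eq)
  obtain C where C: "finite C" "C \<subseteq> E ` W" "E ` W \<subseteq> cvec.span C" "card C = cvec.dim (E ` W)"
    using finite_basis_exists EW by metis
  obtain P where P: "P \<subseteq> W" "finite P" "C = E ` P" "inj_on E P"
    using C(1,2) by (metis subset_image_inj finite_image_iff)
  have "W \<subseteq> cvec.span (B \<union> P)"
  proof
    fix w assume w: "w \<in> W"
    then have "E w \<in> E ` cvec.span P"
      using C(3) P(3) by (auto simp flip: E.span_image)
    then obtain u where u: "u \<in> cvec.span P" "E w = E u" by blast
    have "u \<in> W"
      using u(1) P(1) W(1) cvec.span_minimal by blast
    then have "w - u \<in> {w \<in> W. E w = 0}"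
      using w u(2) W(1) by (simp add: cvec.subspace_diff E.diff)
    then have "(w - u) + u \<in> cvec.span (B \<union> P)"
      using u(1) B(2) by (meson cvec.span_add cvec.span_mono subset_eq sup_ge1 sup_ge2)
    then show "w \<in> cvec.span (B \<union> P)" by simp
  qed
  then have "cvec.dim W \<le> card (B \<union> P)"
    using B(1) P(2) cvec.dim_le_card by blast
  also have "\<dots> \<le> card B + card P"
    by (rule card_Un_le)
  also have "card P = card C"
    using P by (simp add: card_image)
  finally show ?thesis using B(3) C(4) by simp
qed

lemma subspace_linear_kernel:
  assumes "cvec.subspace W" "Vector_Spaces.linear cscale cscale E"
  shows "cvec.subspace {w \<in> W. E w = 0}"
proof -
  interpret E: Vector_Spaces.linear cscale cscale E by (rule assms(2))
  show ?thesis
    using assms(1) by (auto simp: cvec.subspace_def E.add E.scale)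
qed

lemma representation_combination:
  assumes B: "cvec.independent B" "\<And>x. x \<in> I \<Longrightarrow> u x \<in> cvec.span B"
  shows "cvec.representation B (\<Sum>x\<in>I. cscale (v x) (u x)) b
    = (\<Sum>x\<in>I. cvec.representation B (u x) b * v x)"
proof -
  have 1: "cvec.representation B (\<Sum>x\<in>I. cscale (v x) (u x))
      = (\<lambda>b. \<Sum>x\<in>I. cvec.representation B (cscale (v x) (u x)) b)"
    by (rule cvec.representation_sum[OF B(1)]) (rule cvec.span_scale[OF B(2)])
  have 2: "cvec.representation B (cscale (v x) (u x)) b = cvec.representation B (u x) b * v x"
    if "x \<in> I" for x
    unfolding cvec.representation_scale[OF B(1) B(2)[OF that]] by (rule mult.commute)
  show ?thesis unfolding 1 by (rule sum.cong[OF refl 2])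
qed

text \<open>Extend a basis \<open>B\<close> of \<open>S\<close> to a basis \<open>B'\<close> of
  \<open>vecs I\<close>: a vector lies in \<open>S\<close> once its coordinates along
  \<open>B' - B\<close> vanish, and these coordinates are linear forms.\<close>

lemma annihilator_exists:
  assumes "finite I" "cvec.subspace S" "S \<subseteq> vecs I"
  obtains F where "finite F" "card F + cvec.dim S \<le> card I"
    and "\<And>v. v \<in> vecs I \<Longrightarrow> (\<And>f. f \<in> F \<Longrightarrow> (\<Sum>x\<in>I. f x * v x) = 0) \<Longrightarrow> v \<in> S"
proof -
  obtain B where B: "finite B" "B \<subseteq> S" "cvec.independent B" "S \<subseteq> cvec.span B" "card B = cvec.dim S"
    using finite_basis_exists assms(1,3) by metis
  obtain B' where B': "B \<subseteq> B'" "B' \<subseteq> vecs I" "cvec.independent B'" "vecs I \<subseteq> cvec.span B'"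
    using cvec.maximal_independent_subset_extend[of B "vecs I"] B assms(3) by blast
  have card: "card B' = card I"
    using cvec.basis_card_eq_dim[OF B'(2) B'(4) B'(3)] dim_vecs[OF assms(1)] by simp
  have fin: "finite B'"
  proof -
    have "B' \<subseteq> cvec.span (coord_vec ` I)"
      using vecs_subset_span_coord_vec[OF assms(1)] B'(2) by (rule subset_trans[rotated])
    then show ?thesis
      using cvec.independent_span_bound[OF finite_imageI[OF assms(1)] B'(3)] by blast
  qed
  define rep where "rep = cvec.representation B'"
  define F where "F = (\<lambda>b x. rep (coord_vec x) b) ` (B' - B)"
  have span: "coord_vec x \<in> cvec.span B'" if "x \<in> I" for x
    by (rule subsetD[OF B'(4) coord_vec_in_vecs[OF that]])
  have "v \<in> S" if v: "v \<in> vecs I" and F0: "\<And>f. f \<in> F \<Longrightarrow> (\<Sum>x\<in>I. f x * v x) = 0" for v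
  proof -
    have rep0: "rep v b = 0" if b: "b \<in> B' - B" for b
    proof -
      have "rep v b = rep (\<Sum>x\<in>I. cscale (v x) (coord_vec x)) b"
        by (rule arg_cong[OF vecs_expand[OF assms(1) v], of "\<lambda>w. rep w b"])
      also have "\<dots> = (\<Sum>x\<in>I. rep (coord_vec x) b * v x)"
        unfolding rep_def by (rule representation_combination[OF B'(3) span])
      also have "\<dots> = 0"
        by (rule F0[of "\<lambda>x. rep (coord_vec x) b"]) (unfold F_def, rule imageI[OF b])
      finally show ?thesis .
    qed
    have "v \<in> cvec.span B'"
      by (rule subsetD[OF B'(4) v])
    then have "v = (\<Sum>b\<in>B'. cscale (rep v b) b)"
      unfolding rep_def
      by (rule cvec.sum_representation_eq[OF B'(3) _ fin subset_refl, symmetric])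
    also have "\<dots> = (\<Sum>b\<in>B. cscale (rep v b) b)"
      by (rule sum.mono_neutral_right) (use fin B' rep0 in auto)
    also have "\<dots> \<in> S"
      using B(2) assms(2) by (auto intro!: cvec.subspace_sum cvec.subspace_scale)
    finally show ?thesis .
  qed
  moreover have "finite F"
    using fin by (simp add: F_def)
  moreover have "card F + cvec.dim S \<le> card I"
  proof -
    have "card F \<le> card (B' - B)"
      unfolding F_def using fin by (intro card_image_le) simp
    moreover have "card (B' - B) = card B' - card B" "card B \<le> card B'"
      using fin B(1) B'(1) by (auto simp: card_Diff_subset card_mono)
    ultimately show ?thesis using B(5) card by linarith
  qed
  ultimately show ?thesis
    using that by blast
qed

text \<open>Induction on the number of operators. Since they commute, the kernel of one of them is
  again a graded family stable under the others. By rank-nullity the dimension grows in each degree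
  by at most that of the kernel, and summing over the degrees raises the exponent by one.\<close>

lemma dim_eventually_le_power:
  fixes E :: "'f \<Rightarrow> ('i \<Rightarrow> complex) \<Rightarrow> ('i \<Rightarrow> complex)"
  assumes "finite F" "F \<noteq> {}"
    and lin: "\<And>f. f \<in> F \<Longrightarrow> Vector_Spaces.linear cscale cscale (E f)"
    and comm: "\<And>f g c. f \<in> F \<Longrightarrow> g \<in> F \<Longrightarrow> E f (E g c) = E g (E f c)"
    and J: "\<And>m. finite (J m)"
    and W: "\<And>m. cvec.subspace (W m)" "\<And>m. W m \<subseteq> vecs (J m)"
    and EW: "\<And>f m. f \<in> F \<Longrightarrow> E f ` W (Suc m) \<subseteq> W m"
    and ker: "\<And>m c. N \<le> m \<Longrightarrow> c \<in> W m \<Longrightarrow> (\<And>f. f \<in> F \<Longrightarrow> E f c = 0) \<Longrightarrow> c = 0"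
  shows "\<exists>C. \<forall>m\<ge>N. cvec.dim (W m) \<le> C * (m + 1) ^ (card F - 1)"
  using assms
proof (induction F arbitrary: W rule: finite_ne_induct)
  case (singleton f)
  \<comment> \<open>A single operator is injective from degree \<open>N\<close> on, so the
    dimensions cannot grow.\<close>
  have "cvec.dim (W m) \<le> cvec.dim (W N)" if "N \<le> m" for m
    using that
  proof (induction m rule: dec_induct)
    case (step m)
    have "cvec.dim (W (Suc m)) \<le> cvec.dim {w \<in> W (Suc m). E f w = 0} + cvec.dim (E f ` W (Suc m))"
      using singleton.prems(6)[of f m] singleton.prems(5)[of m]
      by (intro dim_le_kernel_plus_image[where J = "J (Suc m)" and J' = "J m"] singleton.prems) auto
    also have "{w \<in> W (Suc m). E f w = 0} \<subseteq> {0}"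
      using singleton.prems(7)[of "Suc m"] step(1) by (auto simp del: zero_fun_apply)
    then have "cvec.dim {w \<in> W (Suc m). E f w = 0} = 0"
      using cvec.dim_le_card[of "{w \<in> W (Suc m). E f w = 0}" "{}"] by simp
    also have "cvec.dim (E f ` W (Suc m)) \<le> cvec.dim (W m)"
      by (intro dim_mono_vecs[of "J m"] singleton.prems) simp
    finally show ?case using step by simp
  qed simp
  then show ?case by auto
next
  case (insert f F)
  define K where "K m = {c \<in> W m. E f c = 0}" for m
  have "\<exists>C. \<forall>m\<ge>N. cvec.dim (K m) \<le> C * (m + 1) ^ (card F - 1)"
  proof (rule insert.IH)
    show "cvec.subspace (K m)" for m
      unfolding K_def by (intro subspace_linear_kernel insert.prems) simp
    show "K m \<subseteq> vecs (J m)" for m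
      unfolding K_def using insert.prems(5)[of m] by blast
    show "E g ` K (Suc m) \<subseteq> K m" if "g \<in> F" for g m
    proof -
      interpret Vector_Spaces.linear cscale cscale "E g"
        using insert.prems(1) that by blast
      have "E f (E g c) = 0" if "E f c = 0" for c
        using insert.prems(2)[of f g c] that \<open>g \<in> F\<close> zero by (metis insertCI)
      then show ?thesis
        unfolding K_def using insert.prems(6)[of g m] that by blast
    qed
    show "c = 0" if "N \<le> m" "c \<in> K m" "\<And>g. g \<in> F \<Longrightarrow> E g c = 0" for m c
      using that insert.prems(7)[of m c] unfolding K_def by blast
  qed (use insert.prems(1,2,3) in auto)
  then obtain C where C: "\<And>m. N \<le> m \<Longrightarrow> cvec.dim (K m) \<le> C * (m + 1) ^ (card F - 1)" by blast
  define r where "r = card F - 1"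
  have r: "card F = Suc r"
    using insert.hyps by (metis r_def card_gt_0_iff Suc_diff_1)
  \<comment> \<open>One constant covers both the start \<open>N\<close> and the increments, because
    \<open>(m + 2) ^ r + (m + 1) * (m + 2) ^ r = (m + 2) ^ Suc r\<close>.\<close>
  have "cvec.dim (W m) \<le> (cvec.dim (W N) + C) * (m + 1) ^ Suc r" if "N \<le> m" for m
    using that
  proof (induction m rule: dec_induct)
    case base
    have "cvec.dim (W N) * 1 \<le> (cvec.dim (W N) + C) * (N + 1) ^ Suc r"
      by (intro mult_le_mono one_le_power) auto
    then show ?case by simp
  next
    case (step m)
    have "cvec.dim (W (Suc m)) \<le> cvec.dim (K (Suc m)) + cvec.dim (E f ` W (Suc m))"
      unfolding K_def
      using insert.prems(6)[of f m] insert.prems(5)[of m]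
      by (intro dim_le_kernel_plus_image[where J = "J (Suc m)" and J' = "J m"] insert.prems) auto
    also have "cvec.dim (E f ` W (Suc m)) \<le> cvec.dim (W m)"
      by (intro dim_mono_vecs[of "J m"] insert.prems) simp
    also have "cvec.dim (K (Suc m)) \<le> (cvec.dim (W N) + C) * (m + 2) ^ r"
    proof -
      have "cvec.dim (K (Suc m)) \<le> C * (m + 2) ^ r"
        using C[of "Suc m"] step by (simp add: r_def)
      then show ?thesis by (simp add: add_mult_distrib)
    qed
    also have "cvec.dim (W m) \<le> (cvec.dim (W N) + C) * ((m + 1) * (m + 2) ^ r)"
    proof -
      have "(m + 1) ^ Suc r \<le> (m + 1) * (m + 2) ^ r"
        unfolding power_Suc by (intro mult_le_mono power_mono) auto
      then show ?thesis
        using step.IH by (meson le_trans mult_le_mono2)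
    qed
    finally show ?case by (simp add: algebra_simps)
  qed
  then show ?case
    using insert.hyps r by auto
qed

subsection \<open>Multihomogeneous exponents\<close>

text \<open>
  An element \<open>\<alpha>\<close> of \<open>exponents p d l\<close> stands for the monomial \<open>\<Prod>k i. X k i ^ \<alpha> k i\<close>, of degree \<open>l k\<close>
  in the variables \<open>X k 0, \<dots>, X k (d k - 1)\<close>.
\<close>

definition exponents :: "nat \<Rightarrow> (nat \<Rightarrow> nat) \<Rightarrow> (nat \<Rightarrow> nat) \<Rightarrow> (nat \<Rightarrow> nat \<Rightarrow> nat) set" where
  "exponents p d l = {\<alpha>. (\<forall>k\<in>{1..p}. (\<Sum>i<d k. \<alpha> k i) = l k) \<and>
     (\<forall>k i. k \<notin> {1..p} \<or> d k \<le> i \<longrightarrow> \<alpha> k i = 0)}"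

text \<open>The exponent of the monomial \<open>\<Prod>k\<in>B. X k (x k)\<close>; adding it means
  multiplying by this monomial.\<close>

definition unit_exp :: "nat set \<Rightarrow> (nat \<Rightarrow> nat) \<Rightarrow> nat \<Rightarrow> nat \<Rightarrow> nat" where
  "unit_exp B x = (\<lambda>k i. if k \<in> B \<and> i = x k then 1 else 0)"

definition exp_fact :: "nat \<Rightarrow> (nat \<Rightarrow> nat) \<Rightarrow> (nat \<Rightarrow> nat \<Rightarrow> nat) \<Rightarrow> nat" where
  "exp_fact p d \<alpha> = (\<Prod>k\<in>{1..p}. \<Prod>i<d k. fact (\<alpha> k i))"

lemma exp_fact_pos: "0 < exp_fact p d \<alpha>"
  by (simp add: exp_fact_def prod_pos)

lemma exponents_cong:
  assumes "\<And>k. k \<in> {1..p} \<Longrightarrow> l k = l' k"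
  shows "exponents p d l = exponents p d l'"
  using assms by (simp add: exponents_def)

lemma exponents_le:
  assumes "\<alpha> \<in> exponents p d l" "k \<in> {1..p}"
  shows "\<alpha> k i \<le> l k"
proof (cases "i < d k")
  case True
  then have "\<alpha> k i \<le> (\<Sum>i<d k. \<alpha> k i)"
    by (intro member_le_sum) auto
  then show ?thesis
    using assms by (auto simp: exponents_def)
next
  case False
  then show ?thesis
    using assms by (auto simp: exponents_def)
qed

lemma finite_exponents: "finite (exponents p d l)"
proof -
  define R where "R = (\<Sum>k\<in>{1..p}. l k)"
  define D where "D = (\<Sum>k\<in>{1..p}. d k)"
  have "exponents p d l \<subseteq> (\<lambda>f k i. if (k, i) \<in> {1..p} \<times> {..<D} then f (k, i) else 0) ` 
      (({1..p} \<times> {..<D}) \<rightarrow>\<^sub>E {..R})"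
  proof
    fix \<alpha> assume \<alpha>: "\<alpha> \<in> exponents p d l"
    have R: "\<alpha> k i \<le> R" if "k \<in> {1..p}" for k i
    proof -
      have "\<alpha> k i \<le> l k"
        by (rule exponents_le[OF \<alpha> that])
      also have "l k \<le> R"
        unfolding R_def using that by (intro member_le_sum) auto
      finally show ?thesis .
    qed
    have D: "d k \<le> D" if "k \<in> {1..p}" for k
      unfolding D_def using that by (intro member_le_sum) auto
    have 0: "\<alpha> k i = 0" if "\<not> (k \<in> {1..p} \<and> i < D)" for k i
    proof (cases "k \<in> {1..p}")
      case True
      then show ?thesis using \<alpha> that D[OF True] by (simp add: exponents_def)
    next
      case False
      then show ?thesis using \<alpha> by (simp add: exponents_def)
    qed
    show "\<alpha> \<in> (\<lambda>f k i. if (k, i) \<in> {1..p} \<times> {..<D} then f (k, i) else 0) ` 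
      (({1..p} \<times> {..<D}) \<rightarrow>\<^sub>E {..R})"
      by (rule image_eqI[of _ _ "\<lambda>z\<in>{1..p} \<times> {..<D}. \<alpha> (fst z) (snd z)"])
        (use R 0 in \<open>auto simp: fun_eq_iff\<close>)
  qed
  then show ?thesis
    by (rule finite_subset) (intro finite_imageI finite_PiE finite_SigmaI, auto)
qed

lemma sum_unit_exp:
  assumes "k \<in> B \<longrightarrow> x k < d k"
  shows "(\<Sum>i<d k. unit_exp B x k i) = (if k \<in> B then 1 else 0)"
proof -
  have "(\<Sum>i<d k. unit_exp B x k i) = (\<Sum>i<d k. if i = x k then (if k \<in> B then 1 else 0) else 0)"
    by (intro sum.cong) (auto simp: unit_exp_def)
  also have "\<dots> = (if k \<in> B then 1 else 0)"
    using assms by (subst sum.delta) auto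
  finally show ?thesis .
qed

lemma add_unit_exp_in_exponents_iff:
  assumes "B \<subseteq> {1..p}" "\<And>k. k \<in> B \<Longrightarrow> x k < d k"
  shows "\<gamma> + unit_exp B x \<in> exponents p d (\<lambda>k. l k + (if k \<in> B then 1 else 0)) \<longleftrightarrow> \<gamma> \<in> exponents p d l"
proof -
  have "(\<Sum>i<d k. (\<gamma> + unit_exp B x) k i) = (\<Sum>i<d k. \<gamma> k i) + (if k \<in> B then 1 else 0)" for k
    using sum_unit_exp[of k B x d] assms(2) by (simp add: sum.distrib)
  moreover have "(\<gamma> + unit_exp B x) k i = \<gamma> k i" if "k \<notin> {1..p} \<or> d k \<le> i" for k i
    using that assms by (fastforce simp: unit_exp_def)
  ultimately show ?thesis
    unfolding exponents_def by auto
qed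

lemma exp_fact_add_unit_exp:
  assumes "B \<subseteq> {1..p}" "\<And>k. k \<in> B \<Longrightarrow> x k < d k"
  shows "exp_fact p d (\<gamma> + unit_exp B x) = exp_fact p d \<gamma> * (\<Prod>k\<in>B. Suc (\<gamma> k (x k)))"
proof -
  have 1: "(\<Prod>i<d k. fact ((\<gamma> + unit_exp B x) k i)) =
      (\<Prod>i<d k. fact (\<gamma> k i)) * (if k \<in> B then Suc (\<gamma> k (x k)) else (1::nat))" for k
  proof (cases "k \<in> B")
    case True
    then have "(\<Prod>i<d k. fact ((\<gamma> + unit_exp B x) k i)) =
        (\<Prod>i<d k. fact (\<gamma> k i) * (if i = x k then Suc (\<gamma> k (x k)) else (1::nat)))"
      by (intro prod.cong) (auto simp: unit_exp_def)
    also have "\<dots> = (\<Prod>i<d k. fact (\<gamma> k i)) * (if k \<in> B then Suc (\<gamma> k (x k)) else (1::nat))"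
      using True assms(2) by (simp add: prod.distrib prod.delta del: prod.lessThan_Suc)
    finally show ?thesis .
  qed (simp add: unit_exp_def)
  have "exp_fact p d (\<gamma> + unit_exp B x) =
      exp_fact p d \<gamma> * (\<Prod>k\<in>{1..p}. if k \<in> B then Suc (\<gamma> k (x k)) else 1)"
    unfolding exp_fact_def 1 by (rule prod.distrib)
  also have "(\<Prod>k\<in>{1..p}. if k \<in> B then Suc (\<gamma> k (x k)) else 1) = (\<Prod>k\<in>B. Suc (\<gamma> k (x k)))"
    using assms(1) by (simp add: prod.If_cases Int_absorb1)
  finally show ?thesis .
qed

text \<open>Substitute \<open>\<beta> = \<gamma> + unit_exp B x\<close>: exponents not of this form
  have a factor \<open>\<beta> k (x k) = 0\<close>, and for the others the product cancels against
  the quotient of the factorials. This is the adjointness of creation and annihilation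
  operators.\<close>

lemma sum_raise_exponents:
  fixes F :: "(nat \<Rightarrow> nat \<Rightarrow> nat) \<Rightarrow> 'a::field_char_0"
  assumes B: "B \<subseteq> {1..p}" "\<And>k. k \<in> B \<Longrightarrow> x k < d k"
  shows "(\<Sum>\<beta>\<in>exponents p d (\<lambda>k. l k + (if k \<in> B then 1 else 0)).
            F \<beta> * of_nat (\<Prod>k\<in>B. \<beta> k (x k)) / of_nat (exp_fact p d \<beta>))
       = (\<Sum>\<gamma>\<in>exponents p d l. F (\<gamma> + unit_exp B x) / of_nat (exp_fact p d \<gamma>))"
proof -
  let ?raise = "\<lambda>\<gamma>. \<gamma> + unit_exp B x"
  let ?g = "\<lambda>\<beta>. F \<beta> * of_nat (\<Prod>k\<in>B. \<beta> k (x k)) / of_nat (exp_fact p d \<beta>)"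
  have fin: "finite B" using B(1) finite_subset by blast
  have "(\<Sum>\<beta>\<in>exponents p d (\<lambda>k. l k + (if k \<in> B then 1 else 0)). ?g \<beta>)
      = (\<Sum>\<beta>\<in>?raise ` exponents p d l. ?g \<beta>)"
  proof (rule sum.mono_neutral_right)
    show "?raise ` exponents p d l \<subseteq> exponents p d (\<lambda>k. l k + (if k \<in> B then 1 else 0))"
    proof (rule image_subsetI)
      fix \<gamma> assume "\<gamma> \<in> exponents p d l"
      then show "?raise \<gamma> \<in> exponents p d (\<lambda>k. l k + (if k \<in> B then 1 else 0))"
        by (simp only: add_unit_exp_in_exponents_iff[of B p x d \<gamma> l, OF B])
    qed
    show "\<forall>\<beta>\<in>exponents p d (\<lambda>k. l k + (if k \<in> B then 1 else 0)) - ?raise ` exponents p d l. ?g \<beta> = 0"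
    proof
      fix \<beta> assume \<beta>: "\<beta> \<in> exponents p d (\<lambda>k. l k + (if k \<in> B then 1 else 0)) - ?raise ` exponents p d l"
      have "\<exists>k\<in>B. \<beta> k (x k) = 0"
      proof (rule ccontr)
        assume "\<not> ?thesis"
        \<comment> \<open>All these entries being positive, adding the unit exponent undoes the
          truncated subtraction.\<close>
        then have *: "\<beta> = ?raise (\<lambda>k i. \<beta> k i - unit_exp B x k i)"
          by (intro ext) (auto simp: unit_exp_def)
        have "(\<lambda>k i. \<beta> k i - unit_exp B x k i) \<in> exponents p d l"
          using add_unit_exp_in_exponents_iff[of B p x d "\<lambda>k i. \<beta> k i - unit_exp B x k i" l, OF B]
            \<beta>[unfolded Diff_iff] by (simp only: *[symmetric])
        then have "?raise (\<lambda>k i. \<beta> k i - unit_exp B x k i) \<in> ?raise ` exponents p d l"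
          by (rule imageI)
        then have "\<beta> \<in> ?raise ` exponents p d l"
          by (simp only: *[symmetric])
        then show False
          using \<beta> by blast
      qed
      then show "?g \<beta> = 0" using fin by simp
    qed
  qed (rule finite_exponents)
  also have "\<dots> = (\<Sum>\<gamma>\<in>exponents p d l. ?g (?raise \<gamma>))"
    by (subst sum.reindex) (simp_all only: o_def inj_on_def add_right_cancel, simp)
  also have "\<dots> = (\<Sum>\<gamma>\<in>exponents p d l. F (?raise \<gamma>) / of_nat (exp_fact p d \<gamma>))"
  proof (rule sum.cong[OF refl])
    fix \<gamma>
    have "(\<Prod>k\<in>B. ?raise \<gamma> k (x k)) = (\<Prod>k\<in>B. Suc (\<gamma> k (x k)))"
      by (intro prod.cong) (auto simp: unit_exp_def)
    moreover have "(of_nat (\<Prod>k\<in>B. Suc (\<gamma> k (x k))) :: 'a) \<noteq> 0"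
      using fin by (simp only: of_nat_eq_0_iff prod_zero_iff) simp
    ultimately show "?g (?raise \<gamma>) = F (?raise \<gamma>) / of_nat (exp_fact p d \<gamma>)"
      using exp_fact_add_unit_exp[of B p x d \<gamma>, OF B]
      by (simp only: of_nat_mult) (simp del: of_nat_prod of_nat_Suc plus_fun_apply)
  qed
  finally show ?thesis .
qed

section \<open>Multi-indices: one basis vector for each factor\<close>

lemma multi_indices_iff:
  "x \<in> multi_indices p d \<longleftrightarrow> (\<forall>k\<in>{1..p}. x k < d k) \<and> (\<forall>k. k \<notin> {1..p} \<longrightarrow> x k = undefined)"
  by (auto simp: multi_indices_def PiE_iff extensional_def)

lemma finite_multi_indices: "finite (multi_indices p d)"
  unfolding multi_indices_def by (intro finite_PiE) auto

lemma card_multi_indices: "card (multi_indices p d) = (\<Prod>k=1..p. d k)"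
  unfolding multi_indices_def by (simp add: card_PiE)

text \<open>Distributivity turns the sum into a product of degrees; this yields the trace of the
  reduced state.\<close>

lemma sum_prod_multi_indices:
  fixes \<alpha> :: "nat \<Rightarrow> nat \<Rightarrow> nat"
  assumes "\<alpha> \<in> exponents p d (\<lambda>_. m)"
  shows "(\<Sum>x\<in>multi_indices p d. \<Prod>k\<in>{1..p}. \<alpha> k (x k)) = m ^ p"
proof -
  have "(\<Sum>x\<in>multi_indices p d. \<Prod>k\<in>{1..p}. \<alpha> k (x k)) = (\<Prod>k\<in>{1..p}. \<Sum>i<d k. \<alpha> k i)"
    unfolding multi_indices_def by (subst prod_sum_PiE) auto
  also have "\<dots> = (\<Prod>k\<in>{1..p}. m)"
    using assms by (intro prod.cong) (auto simp: exponents_def)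
  finally show ?thesis by simp
qed

subsection \<open>Contraction with multilinear forms\<close>

text \<open>
  A function \<open>c\<close> on exponents of degree \<open>m\<close> is regarded as a linear functional on the multihomogeneous
  polynomials of degree \<open>(m, \<dots>, m)\<close>; \<open>contract p d f c\<close> is its composition with multiplication by the
  multilinear form whose coefficients are given by \<open>f\<close>.
\<close>

definition contract ::
    "nat \<Rightarrow> (nat \<Rightarrow> nat) \<Rightarrow> ((nat \<Rightarrow> nat) \<Rightarrow> complex) \<Rightarrow> ((nat \<Rightarrow> nat \<Rightarrow> nat) \<Rightarrow> complex) \<Rightarrow>
      (nat \<Rightarrow> nat \<Rightarrow> nat) \<Rightarrow> complex" where
  "contract p d f c = (\<lambda>\<beta>. \<Sum>x\<in>multi_indices p d. f x * c (\<beta> + unit_exp {1..p} x))"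

lemma linear_contract: "Vector_Spaces.linear cscale cscale (contract p d f)"
  unfolding linear_cscale_iff contract_def cscale_def
  by (auto simp: fun_eq_iff sum.distrib sum_distrib_left algebra_simps)

text \<open>Both sides compose \<open>c\<close> with multiplication by the product of the two
  forms.\<close>

lemma contract_commute: "contract p d f (contract p d g c) = contract p d g (contract p d f c)"
proof
  fix \<beta>
  have "contract p d f (contract p d g c) \<beta> =
      (\<Sum>x\<in>multi_indices p d. \<Sum>y\<in>multi_indices p d.
        f x * (g y * c (\<beta> + unit_exp {1..p} x + unit_exp {1..p} y)))"
    by (simp only: contract_def sum_distrib_left)
  also have "\<dots> = (\<Sum>y\<in>multi_indices p d. \<Sum>x\<in>multi_indices p d.
        f x * (g y * c (\<beta> + unit_exp {1..p} x + unit_exp {1..p} y)))"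
    by (rule sum.swap)
  also have "\<dots> = (\<Sum>y\<in>multi_indices p d. \<Sum>x\<in>multi_indices p d.
        g y * (f x * c (\<beta> + unit_exp {1..p} y + unit_exp {1..p} x)))"
    by (intro sum.cong refl) (simp only: ac_simps)
  also have "\<dots> = contract p d g (contract p d f c) \<beta>"
    by (simp only: contract_def sum_distrib_left)
  finally show "contract p d f (contract p d g c) \<beta> = contract p d g (contract p d f c) \<beta>" .
qed

lemma add_unit_exp_level_iff:
  assumes "x \<in> multi_indices p d"
  shows "\<gamma> + unit_exp {1..p} x \<in> exponents p d (\<lambda>_. Suc m) \<longleftrightarrow> \<gamma> \<in> exponents p d (\<lambda>_. m)"
proof -
  have "exponents p d (\<lambda>_. Suc m) = exponents p d (\<lambda>k. m + (if k \<in> {1..p} then 1 else 0))"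
    by (rule exponents_cong) simp
  then show ?thesis
    using add_unit_exp_in_exponents_iff[of "{1..p}" p x d \<gamma> "\<lambda>_. m"] assms
    by (simp only: multi_indices_iff)
qed

lemma contract_in_vecs:
  assumes "c \<in> vecs (exponents p d (\<lambda>_. Suc m))"
  shows "contract p d f c \<in> vecs (exponents p d (\<lambda>_. m))"
  unfolding vecs_def mem_Collect_eq
proof (intro allI impI)
  fix \<beta> assume \<beta>: "\<beta> \<notin> exponents p d (\<lambda>_. m)"
  have "c (\<beta> + unit_exp {1..p} x) = 0" if "x \<in> multi_indices p d" for x
    using assms \<beta> add_unit_exp_level_iff[OF that, of \<beta> m] by (simp add: vecs_def)
  then show "contract p d f c \<beta> = 0"
    unfolding contract_def by (intro sum.neutral) simp
qed

text \<open>Dually: if the ideal of the forms contains everything in degree \<open>m\<close>, so it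
  does in degree \<open>Suc m\<close>, because each monomial there is a multilinear monomial times
  one of degree \<open>m\<close>.\<close>

lemma contract_kernel_trivial_Suc:
  assumes ker: "\<And>c. c \<in> vecs (exponents p d (\<lambda>_. m)) \<Longrightarrow> (\<And>f. f \<in> F \<Longrightarrow> contract p d f c = 0) \<Longrightarrow> c = 0"
    and c: "c \<in> vecs (exponents p d (\<lambda>_. Suc m))" "\<And>f. f \<in> F \<Longrightarrow> contract p d f c = 0"
  shows "c = 0"
proof
  fix \<alpha>
  show "c \<alpha> = 0 \<alpha>"
  proof (cases "\<alpha> \<in> exponents p d (\<lambda>_. Suc m)")
    case True
    have "\<exists>i<d k. 0 < \<alpha> k i" if "k \<in> {1..p}" for k
    proof (rule ccontr)
      assume "\<not> ?thesis"
      then have "(\<Sum>i<d k. \<alpha> k i) = 0" by simp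
      moreover have "(\<Sum>i<d k. \<alpha> k i) = Suc m"
        using True that unfolding exponents_def by blast
      ultimately show False by simp
    qed
    \<comment> \<open>The degree in each factor is positive, so one variable of every factor can be
      split off from \<open>\<alpha>\<close>.\<close>
    then obtain x' where x': "\<And>k. k \<in> {1..p} \<Longrightarrow> x' k < d k \<and> 0 < \<alpha> k (x' k)" by metis
    define x where "x = restrict x' {1..p}"
    have x: "x \<in> multi_indices p d"
      using x' by (simp add: multi_indices_iff x_def)
    define \<gamma> where "\<gamma> = (\<lambda>k i. \<alpha> k i - unit_exp {1..p} x k i)"
    have \<alpha>: "\<alpha> = \<gamma> + unit_exp {1..p} x"
    proof (intro ext)
      fix k i
      show "\<alpha> k i = (\<gamma> + unit_exp {1..p} x) k i"
        using x'[of k] by (auto simp: \<gamma>_def x_def unit_exp_def)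
    qed
    \<comment> \<open>\<open>c'\<close> is \<open>c\<close> composed with multiplication by the
      monomial of \<open>x\<close>, so the contractions still annihilate it.\<close>
    define c' where "c' = (\<lambda>\<beta>. c (\<beta> + unit_exp {1..p} x))"
    have "c' \<in> vecs (exponents p d (\<lambda>_. m))"
      using c(1) add_unit_exp_level_iff[OF x, of _ m] by (simp add: vecs_def c'_def)
    moreover have "contract p d f c' = 0" if "f \<in> F" for f
    proof
      fix \<beta>
      have "contract p d f c' \<beta> = contract p d f c (\<beta> + unit_exp {1..p} x)"
        unfolding contract_def c'_def by (simp only: ac_simps)
      then show "contract p d f c' \<beta> = 0 \<beta>"
        by (simp only: c(2)[OF that] zero_fun_apply)
    qed
    ultimately have "c' = 0" by (rule ker)
    then have "c' \<gamma> = 0" by simp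
    then show ?thesis unfolding c'_def \<alpha>[symmetric] by simp
  next
    case False
    then show ?thesis using c(1) by (simp add: vecs_def)
  qed
qed

text \<open>In each factor the exponents of the variables with index at least 1 range freely over
  \<open>{..q}\<close>, and the variable with index 0 fills up the degree. The degree
  \<open>q * D\<close> leaves room for this because \<open>d k \<le> D\<close>.\<close>

lemma exponents_card_ge:
  assumes d: "\<And>k. k \<in> {1..p} \<Longrightarrow> 0 < d k"
  shows "(q + 1) ^ (\<Sum>k\<in>{1..p}. d k - 1) \<le> card (exponents p d (\<lambda>_. q * (\<Sum>k\<in>{1..p}. d k)))"
proof -
  define D where "D = (\<Sum>k\<in>{1..p}. d k)"
  define Z where "Z = (SIGMA k:{1..p}. {1..<d k})"
  define \<phi> where "\<phi> g = (\<lambda>k i. if (k, i) \<in> Z then g (k, i)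
      else if k \<in> {1..p} \<and> i = 0 then q * D - (\<Sum>i\<in>{1..<d k}. g (k, i)) else 0)"
    for g :: "nat \<times> nat \<Rightarrow> nat"
  have finZ: "finite Z"
    by (auto simp: Z_def)
  have cardZ: "card Z = (\<Sum>k\<in>{1..p}. d k - 1)"
    unfolding Z_def by (subst card_SigmaI) auto
  have range: "\<phi> g \<in> exponents p d (\<lambda>_. q * D)" if g: "g \<in> Z \<rightarrow>\<^sub>E {..q}" for g
  proof -
    have "(\<Sum>i<d k. \<phi> g k i) = q * D" if k: "k \<in> {1..p}" for k
    proof -
      have "(\<Sum>i\<in>{1..<d k}. g (k, i)) \<le> (\<Sum>i\<in>{1..<d k}. q)"
        using g k by (intro sum_mono) (auto simp: Z_def PiE_iff)
      also have "\<dots> = q * (d k - 1)"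
        by simp
      also have "\<dots> \<le> q * D"
        using member_le_sum[of k "{1..p}" d] k by (intro mult_le_mono2) (auto simp: D_def)
      finally have le: "(\<Sum>i\<in>{1..<d k}. g (k, i)) \<le> q * D" .
      have "{..<d k} = insert 0 {1..<d k}"
        using d[OF k] by auto
      then have "(\<Sum>i<d k. \<phi> g k i) = \<phi> g k 0 + (\<Sum>i\<in>{1..<d k}. \<phi> g k i)"
        by simp
      also have "(\<Sum>i\<in>{1..<d k}. \<phi> g k i) = (\<Sum>i\<in>{1..<d k}. g (k, i))"
        using k by (intro sum.cong) (auto simp: \<phi>_def Z_def)
      also have "\<phi> g k 0 = q * D - (\<Sum>i\<in>{1..<d k}. g (k, i))"
        using k by (simp add: \<phi>_def Z_def)
      finally show ?thesis using le by simp
    qed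
    moreover have "\<phi> g k i = 0" if "k \<notin> {1..p} \<or> d k \<le> i" for k i
      using that d[of k] by (auto simp: \<phi>_def Z_def)
    ultimately show ?thesis by (simp add: exponents_def)
  qed
  have inj: "inj_on \<phi> (Z \<rightarrow>\<^sub>E {..q})"
  proof (rule inj_onI)
    fix g h assume g: "g \<in> Z \<rightarrow>\<^sub>E {..q}" and h: "h \<in> Z \<rightarrow>\<^sub>E {..q}" and eq: "\<phi> g = \<phi> h"
    have "g z = h z" if "z \<in> Z" for z
      using fun_cong[OF fun_cong[OF eq], of "fst z" "snd z"] that by (simp add: \<phi>_def)
    then show "g = h" by (rule PiE_ext[OF g h])
  qed
  have "card (Z \<rightarrow>\<^sub>E {..q}) \<le> card (exponents p d (\<lambda>_. q * D))"
    by (rule card_inj_on_le[OF inj image_subsetI[OF range] finite_exponents])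
  moreover have "card (Z \<rightarrow>\<^sub>E {..q}) = (q + 1) ^ card Z"
    using finZ by (simp add: card_PiE)
  ultimately show ?thesis
    unfolding cardZ D_def by simp
qed

text \<open>
  If the forms had no common kernel in some degree \<open>N\<close>, then the dimension in degree \<open>m\<close> would
  grow at most like \<open>m ^ (card F - 1)\<close>, whereas the number of exponents grows like
  \<open>m ^ (\<Sum>k=1..p. d k - 1)\<close>.
\<close>

lemma contract_kernel_nontrivial:
  assumes d: "\<And>k. k \<in> {1..p} \<Longrightarrow> 0 < d k"
    and F: "finite F" "card F \<le> (\<Sum>k\<in>{1..p}. d k - 1)"
  obtains c where "c \<in> vecs (exponents p d (\<lambda>_. m))" "c \<noteq> 0" "\<And>f. f \<in> F \<Longrightarrow> contract p d f c = 0"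
proof (rule ccontr)
  assume "\<not> thesis"
  then have ker0: "c = 0"
    if "c \<in> vecs (exponents p d (\<lambda>_. m))" "\<And>f. f \<in> F \<Longrightarrow> contract p d f c = 0" for c
    using that \<open>\<And>c. \<lbrakk>c \<in> vecs (exponents p d (\<lambda>_. m)); c \<noteq> 0; \<And>f. f \<in> F \<Longrightarrow> contract p d f c = 0\<rbrakk> \<Longrightarrow> thesis\<close>
    by blast
  \<comment> \<open>Triviality of the common kernel propagates from degree \<open>m\<close> to all
    higher degrees.\<close>
  have ker: "c = 0" if "m \<le> m'" "c \<in> vecs (exponents p d (\<lambda>_. m'))"
      "\<And>f. f \<in> F \<Longrightarrow> contract p d f c = 0" for c m'
    using that
  proof (induction m' arbitrary: c rule: dec_induct)
    case base
    then show ?case by (rule ker0)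
  next
    case (step m')
    show ?case
      by (rule contract_kernel_trivial_Suc[of p d m' F]) (fact step.IH step.prems)+
  qed
  define n where "n = (\<Sum>k\<in>{1..p}. d k - 1)"
  define D where "D = (\<Sum>k\<in>{1..p}. d k)"
  have dim_ge: "(q + 1) ^ n \<le> cvec.dim (vecs (exponents p d (\<lambda>_. q * D)))" for q
    using exponents_card_ge[of p d q, OF d] dim_vecs[OF finite_exponents]
    by (simp only: n_def D_def) 
  show False
  proof (cases "F = {}")
    case True
    \<comment> \<open>Without forms there is no condition on \<open>c\<close>, and reading off the
      coefficient of a single monomial is a nonzero functional. The growth bound needs at least one
      form.\<close>
    define \<alpha> :: "nat \<Rightarrow> nat \<Rightarrow> nat" where "\<alpha> = (\<lambda>k i. if k \<in> {1..p} \<and> i = 0 then m else 0)"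
    have "(\<Sum>i<d k. \<alpha> k i) = m" if "k \<in> {1..p}" for k
    proof -
      have "(\<Sum>i<d k. \<alpha> k i) = (\<Sum>i<d k. if i = 0 then m else 0)"
        using that by (intro sum.cong) (auto simp: \<alpha>_def)
      then show ?thesis using d[OF that] by simp
    qed
    moreover have "\<alpha> k i = 0" if "k \<notin> {1..p} \<or> d k \<le> i" for k i
      using that d[of k] by (auto simp: \<alpha>_def)
    ultimately have \<alpha>: "\<alpha> \<in> exponents p d (\<lambda>_. m)"
      by (simp add: exponents_def)
    have "coord_vec \<alpha> = 0"
      using ker0 coord_vec_in_vecs[OF \<alpha>] True by blast
    then have "coord_vec \<alpha> \<alpha> = 0" by simp
    then show False by (simp add: coord_vec_def)
  next
    case False
    obtain C where C: "\<And>m'. m \<le> m' \<Longrightarrow>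
        cvec.dim (vecs (exponents p d (\<lambda>_. m'))) \<le> C * (m' + 1) ^ (card F - 1)"
    proof -
      have "\<exists>C. \<forall>m'\<ge>m. cvec.dim (vecs (exponents p d (\<lambda>_. m'))) \<le> C * (m' + 1) ^ (card F - 1)"
        by (rule dim_eventually_le_power[of F "contract p d" "\<lambda>m. exponents p d (\<lambda>_. m)"])
          (use ker F(1) False in \<open>auto intro: linear_contract contract_commute
            finite_exponents subspace_vecs contract_in_vecs\<close>)
      then show thesis using that by blast
    qed
    have card: "0 < card F" "0 < n"
      using F False by (auto simp: card_gt_0_iff n_def intro: less_le_trans)
    have D: "0 < D"
    proof (rule ccontr)
      assume "\<not> 0 < D"
      then have "n = 0"
        by (simp add: D_def n_def)
      then show False using card by simp
    qed
    \<comment> \<open>\<open>K\<close> collects the constants so that the growth bound reads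
      \<open>(q + 1) ^ n \<le> K * (q + 1) ^ (n - 1)\<close>, that is, \<open>q + 1 \<le> K\<close>.
      Taking \<open>q\<close> at least \<open>K\<close> contradicts this; taking it at least
      \<open>m\<close> makes the bound applicable in degree \<open>q * D\<close>.\<close>
    define K where "K = C * (D + 1) ^ (n - 1)"
    define q where "q = m + K"
    have "m \<le> q * D"
      using D by (metis q_def le_add1 le_trans mult_le_mono2 nat_mult_1_right Suc_leI One_nat_def)
    have "(q + 1) * (q + 1) ^ (n - 1) = (q + 1) ^ n"
      using card(2) by (metis Suc_diff_1 power_Suc)
    also have "\<dots> \<le> C * (q * D + 1) ^ (card F - 1)"
      using dim_ge[of q] C[OF \<open>m \<le> q * D\<close>] by (rule le_trans)
    also have "\<dots> \<le> C * (q * D + 1) ^ (n - 1)"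
      using F(2) by (intro mult_le_mono2 power_increasing) (auto simp: n_def)
    also have "\<dots> \<le> C * ((D + 1) * (q + 1)) ^ (n - 1)"
      by (intro mult_le_mono2 power_mono) auto
    also have "\<dots> = K * (q + 1) ^ (n - 1)"
      by (simp only: K_def power_mult_distrib mult.assoc)
    finally have "q + 1 \<le> K"
      by (simp only: mult_le_cancel2) simp
    then show False by (simp add: q_def)
  qed
qed

subsection \<open>Reduced states of symmetric tensors\<close>

text \<open>The quadratic form at \<open>v\<close> is the sum of
  \<open>w \<gamma> * (cmod (s \<gamma>))\<^sup>2\<close>, with \<open>s \<gamma>\<close> the inner
  product of \<open>v\<close> and \<open>u \<gamma>\<close>.\<close>

lemma pos_semidef_gram:
  assumes w: "\<And>\<gamma>. \<gamma> \<in> \<Gamma> \<Longrightarrow> 0 \<le> w \<gamma>"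
    and M: "\<And>x y. x \<in> I \<Longrightarrow> y \<in> I \<Longrightarrow>
      M x y = (\<Sum>\<gamma>\<in>\<Gamma>. complex_of_real (w \<gamma>) * (u \<gamma> x * cnj (u \<gamma> y)))"
  shows "pos_semidef I M"
  unfolding pos_semidef_def
proof (intro conjI ballI)
  show "hermitian I M"
    unfolding hermitian_def by (simp add: M mult.commute)
  fix v
  define s where "s \<gamma> = (\<Sum>x\<in>I. cnj (v x) * u \<gamma> x)" for \<gamma>
  have "(\<Sum>x\<in>I. cnj (v x) * mat_vec I M v x) =
      (\<Sum>x\<in>I. \<Sum>y\<in>I. \<Sum>\<gamma>\<in>\<Gamma>. complex_of_real (w \<gamma>) * ((cnj (v x) * u \<gamma> x) * cnj (cnj (v y) * u \<gamma> y)))"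
    unfolding mat_vec_def
    by (simp add: M sum_distrib_left sum_distrib_right algebra_simps)
  also have "\<dots> = (\<Sum>x\<in>I. \<Sum>\<gamma>\<in>\<Gamma>. \<Sum>y\<in>I. complex_of_real (w \<gamma>) * ((cnj (v x) * u \<gamma> x) * cnj (cnj (v y) * u \<gamma> y)))"
    by (intro sum.cong refl sum.swap)
  also have "\<dots> = (\<Sum>\<gamma>\<in>\<Gamma>. \<Sum>x\<in>I. \<Sum>y\<in>I. complex_of_real (w \<gamma>) * ((cnj (v x) * u \<gamma> x) * cnj (cnj (v y) * u \<gamma> y)))"
    by (rule sum.swap)
  also have "\<dots> = (\<Sum>\<gamma>\<in>\<Gamma>. complex_of_real (w \<gamma>) * (s \<gamma> * cnj (s \<gamma>)))"
    by (simp only: s_def cnj_sum sum_product) (simp only: sum_distrib_left)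
  finally have "(\<Sum>x\<in>I. cnj (v x) * mat_vec I M v x) =
      (\<Sum>\<gamma>\<in>\<Gamma>. complex_of_real (w \<gamma>) * (s \<gamma> * cnj (s \<gamma>)))" .
  also have "Re \<dots> = (\<Sum>\<gamma>\<in>\<Gamma>. w \<gamma> * (cmod (s \<gamma>))\<^sup>2)"
    by (simp only: complex_norm_square[symmetric] of_real_mult[symmetric] of_real_sum[symmetric] Re_complex_of_real)
  also have "\<dots> \<ge> 0"
    using w by (intro sum_nonneg mult_nonneg_nonneg) auto
  finally show "0 \<le> Re (\<Sum>x\<in>I. cnj (v x) * mat_vec I M v x)" .
qed

text \<open>
  \<open>c\<close> encodes the vector of the tensor product of the symmetric powers \<open>Sym\<^bsup>Suc m\<^esup>(\<complex>\<^bsup>d k\<^esup>)\<close> whose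
  Fock-space expansion has the coefficients \<open>c \<alpha> / \<alpha>!\<close>; \<open>reduced_mat\<close> is, up to
  normalization, its partial trace over all but one of the \<open>Suc m\<close> copies of every factor.
\<close>

definition reduced_mat ::
    "nat \<Rightarrow> (nat \<Rightarrow> nat) \<Rightarrow> nat \<Rightarrow> ((nat \<Rightarrow> nat \<Rightarrow> nat) \<Rightarrow> complex) \<Rightarrow> (nat \<Rightarrow> nat) \<Rightarrow> (nat \<Rightarrow> nat) \<Rightarrow> complex" where
  "reduced_mat p d m c = (\<lambda>x y. if x \<in> multi_indices p d \<and> y \<in> multi_indices p d
     then \<Sum>\<gamma>\<in>exponents p d (\<lambda>_. m).
       c (\<gamma> + unit_exp {1..p} x) * cnj (c (\<gamma> + unit_exp {1..p} y)) / of_nat (exp_fact p d \<gamma>)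
     else 0)"

text \<open>The squared norm of the encoded vector: its coefficients are
  \<open>c \<alpha> / \<alpha>!\<close>, and the Fock monomials have squared norm \<alpha>!. Here
  \<open>m\<close> is the full degree of \<open>c\<close>, whereas \<open>reduced_mat\<close> takes
  one less.\<close>

definition fock_norm ::
    "nat \<Rightarrow> (nat \<Rightarrow> nat) \<Rightarrow> nat \<Rightarrow> ((nat \<Rightarrow> nat \<Rightarrow> nat) \<Rightarrow> complex) \<Rightarrow> real" where
  "fock_norm p d m c = (\<Sum>\<alpha>\<in>exponents p d (\<lambda>_. m). (cmod (c \<alpha>))\<^sup>2 / real (exp_fact p d \<alpha>))"

lemma fock_norm_pos:
  assumes "c \<in> vecs (exponents p d (\<lambda>_. m))" "c \<noteq> 0"
  shows "0 < fock_norm p d m c"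
proof -
  obtain \<alpha> where \<alpha>: "c \<alpha> \<noteq> 0"
    using assms(2) by (auto simp: fun_eq_iff)
  then have "\<alpha> \<in> exponents p d (\<lambda>_. m)"
    using assms(1) by (auto simp: vecs_def)
  moreover have "0 < (cmod (c \<alpha>))\<^sup>2 / real (exp_fact p d \<alpha>)"
    using \<alpha> exp_fact_pos[of p d \<alpha>] by simp
  ultimately show ?thesis
    unfolding fock_norm_def by (intro sum_pos2[of _ \<alpha>]) (auto simp: finite_exponents)
qed

lemma pos_semidef_reduced_mat: "pos_semidef (multi_indices p d) (reduced_mat p d m c)"
  by (rule pos_semidef_gram[of "exponents p d (\<lambda>_. m)" "\<lambda>\<gamma>. 1 / real (exp_fact p d \<gamma>)" _ _
        "\<lambda>\<gamma> x. c (\<gamma> + unit_exp {1..p} x)"])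
    (simp_all add: reduced_mat_def)

text \<open>Each column combines the vectors
  \<open>\<lambda>x. c (\<gamma> + unit_exp {1..p} x)\<close>, whose pairing with \<open>f\<close>
  is \<open>contract p d f c \<gamma>\<close>. This keeps the support inside the subspace cut out by
  the forms.\<close>

lemma contract_reduced_mat:
  assumes "contract p d f c = 0"
  shows "(\<Sum>x\<in>multi_indices p d. f x * reduced_mat p d m c x y) = 0"
proof (cases "y \<in> multi_indices p d")
  case True
  have "(\<Sum>x\<in>multi_indices p d. f x * reduced_mat p d m c x y) =
      (\<Sum>x\<in>multi_indices p d. \<Sum>\<gamma>\<in>exponents p d (\<lambda>_. m). 
        f x * c (\<gamma> + unit_exp {1..p} x) * (cnj (c (\<gamma> + unit_exp {1..p} y)) / of_nat (exp_fact p d \<gamma>)))"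
    using True by (simp add: reduced_mat_def sum_distrib_left algebra_simps)
  also have "\<dots> = (\<Sum>\<gamma>\<in>exponents p d (\<lambda>_. m). \<Sum>x\<in>multi_indices p d. 
        f x * c (\<gamma> + unit_exp {1..p} x) * (cnj (c (\<gamma> + unit_exp {1..p} y)) / of_nat (exp_fact p d \<gamma>)))"
    by (rule sum.swap)
  also have "\<dots> = (\<Sum>\<gamma>\<in>exponents p d (\<lambda>_. m). contract p d f c \<gamma> *
        (cnj (c (\<gamma> + unit_exp {1..p} y)) / of_nat (exp_fact p d \<gamma>)))"
    unfolding contract_def sum_distrib_right by (rule refl)
  finally show ?thesis by (simp add: assms)
qed (simp add: reduced_mat_def)

text \<open>The raised degree \<open>l'\<close> is left free outside \<open>{1..p}\<close>, so that
  constant degrees match.\<close>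

lemma sum_raise_exponents':
  fixes F :: "(nat \<Rightarrow> nat \<Rightarrow> nat) \<Rightarrow> 'a::field_char_0"
  assumes "B \<subseteq> {1..p}" "\<And>k. k \<in> B \<Longrightarrow> x k < d k"
    and l': "\<And>k. k \<in> {1..p} \<Longrightarrow> l' k = l k + (if k \<in> B then 1 else 0)"
  shows "(\<Sum>\<gamma>\<in>exponents p d l. F (\<gamma> + unit_exp B x) / of_nat (exp_fact p d \<gamma>)) =
    (\<Sum>\<beta>\<in>exponents p d l'. F \<beta> * of_nat (\<Prod>k\<in>B. \<beta> k (x k)) / of_nat (exp_fact p d \<beta>))"
proof -
  have "exponents p d l' = exponents p d (\<lambda>k. l k + (if k \<in> B then 1 else 0))"
    by (rule exponents_cong) (rule l')
  then show ?thesis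
    using sum_raise_exponents[of B p x d F l] assms(1,2) by presburger
qed

text \<open>Shifting by the unit exponent of \<open>x\<close> weights the term at \<alpha> with
  \<open>\<Prod>k\<in>{1..p}. \<alpha> k (x k)\<close>, and these weights add up over
  \<open>x\<close> to \<open>Suc m ^ p\<close>.\<close>

lemma mat_trace_reduced_mat:
  "mat_trace (multi_indices p d) (reduced_mat p d m c) = of_real (real (Suc m) ^ p * fock_norm p d (Suc m) c)"
proof -
  define F where "F \<alpha> = c \<alpha> * cnj (c \<alpha>)" for \<alpha>
  have "mat_trace (multi_indices p d) (reduced_mat p d m c) =
      (\<Sum>x\<in>multi_indices p d. \<Sum>\<gamma>\<in>exponents p d (\<lambda>_. m).
        F (\<gamma> + unit_exp {1..p} x) / of_nat (exp_fact p d \<gamma>))"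
    by (simp add: mat_trace_def reduced_mat_def F_def)
  also have "\<dots> = (\<Sum>x\<in>multi_indices p d. \<Sum>\<alpha>\<in>exponents p d (\<lambda>_. Suc m).
      F \<alpha> * of_nat (\<Prod>k\<in>{1..p}. \<alpha> k (x k)) / of_nat (exp_fact p d \<alpha>))"
    by (intro sum.cong refl sum_raise_exponents') (auto simp: multi_indices_iff)
  also have "\<dots> = (\<Sum>\<alpha>\<in>exponents p d (\<lambda>_. Suc m). \<Sum>x\<in>multi_indices p d.
      F \<alpha> * of_nat (\<Prod>k\<in>{1..p}. \<alpha> k (x k)) / of_nat (exp_fact p d \<alpha>))"
    by (rule sum.swap)
  also have "\<dots> = (\<Sum>\<alpha>\<in>exponents p d (\<lambda>_. Suc m).
      F \<alpha> * of_nat (\<Sum>x\<in>multi_indices p d. \<Prod>k\<in>{1..p}. \<alpha> k (x k)) / of_nat (exp_fact p d \<alpha>))"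
    by (simp only: of_nat_sum sum_distrib_left sum_divide_distrib)
  also have "\<dots> = (\<Sum>\<alpha>\<in>exponents p d (\<lambda>_. Suc m).
      of_real (real (Suc m) ^ p * ((cmod (c \<alpha>))\<^sup>2 / real (exp_fact p d \<alpha>))))"
  proof (rule sum.cong[OF refl])
    fix \<alpha> assume \<alpha>: "\<alpha> \<in> exponents p d (\<lambda>_. Suc m)"
    show "F \<alpha> * of_nat (\<Sum>x\<in>multi_indices p d. \<Prod>k\<in>{1..p}. \<alpha> k (x k)) / of_nat (exp_fact p d \<alpha>) =
        of_real (real (Suc m) ^ p * ((cmod (c \<alpha>))\<^sup>2 / real (exp_fact p d \<alpha>)))"
      unfolding F_def sum_prod_multi_indices[OF \<alpha>] complex_norm_square[symmetric]
      by (simp del: of_nat_Suc)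
  qed
  finally show ?thesis
    by (simp only: fock_norm_def sum_distrib_left of_real_sum)
qed

text \<open>Replacing the factors one at a time changes the product by at most
  \<open>K ^ (card T - 1)\<close> each. The missing power of \<open>K\<close> makes the commutator
  terms of relative order \<open>1/m\<close>.\<close>

lemma prod_Suc_le:
  fixes g :: "'a \<Rightarrow> nat"
  assumes "finite T" "\<And>k. k \<in> T \<Longrightarrow> Suc (g k) \<le> K"
  shows "(\<Prod>k\<in>T. Suc (g k)) \<le> (\<Prod>k\<in>T. g k) + card T * K ^ (card T - 1)"
  using assms
proof (induction T rule: finite_induct)
  case (insert a T)
  define n where "n = card T"
  have ga: "g a \<le> K" using insert.prems[of a] by simp
  have "(\<Prod>k\<in>T. Suc (g k)) \<le> (\<Prod>k\<in>T. K)"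
    using insert.prems by (intro prod_mono) auto
  then have 1: "(\<Prod>k\<in>T. Suc (g k)) \<le> K ^ n"
    by (simp add: n_def)
  have "(\<Prod>k\<in>T. Suc (g k)) \<le> (\<Prod>k\<in>T. g k) + n * K ^ (n - 1)"
    using insert by (simp add: n_def)
  then have "g a * (\<Prod>k\<in>T. Suc (g k)) \<le> g a * ((\<Prod>k\<in>T. g k) + n * K ^ (n - 1))"
    by (rule mult_le_mono2)
  also have "\<dots> \<le> g a * (\<Prod>k\<in>T. g k) + K * (n * K ^ (n - 1))"
    unfolding distrib_left by (intro add_left_mono mult_le_mono1 ga)
  \<comment> \<open>For \<open>n = 0\<close> both sides vanish, so the truncated
    \<open>n - 1\<close> does no harm.\<close>
  also have "K * (n * K ^ (n - 1)) = n * K ^ n"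
    by (cases n) (auto simp: algebra_simps)
  finally have "Suc (g a) * (\<Prod>k\<in>T. Suc (g k)) \<le> g a * (\<Prod>k\<in>T. g k) + Suc n * K ^ n"
    using 1 by simp
  then show ?case
    using insert.hyps by (simp add: n_def)
qed simp

text \<open>The left side is the squared norm after one annihilation in each factor outside
  \<open>T\<close>; each annihilation contributes an occupation number, which is at most
  \<open>Suc m\<close>.\<close>

lemma sum_lowered_le_fock_norm:
  assumes T: "T \<subseteq> {1..p}" and z: "z \<in> multi_indices p d"
  shows "(\<Sum>\<gamma>\<in>exponents p d (\<lambda>k. m + (if k \<in> T then 1 else 0)).
      (cmod (c (\<gamma> + unit_exp ({1..p} - T) z)))\<^sup>2 / real (exp_fact p d \<gamma>))
    \<le> real (Suc m) ^ card ({1..p} - T) * fock_norm p d (Suc m) c"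
proof -
  have "(\<Sum>\<gamma>\<in>exponents p d (\<lambda>k. m + (if k \<in> T then 1 else 0)).
      (cmod (c (\<gamma> + unit_exp ({1..p} - T) z)))\<^sup>2 / real (exp_fact p d \<gamma>)) =
    (\<Sum>\<alpha>\<in>exponents p d (\<lambda>_. Suc m).
      (cmod (c \<alpha>))\<^sup>2 * real (\<Prod>k\<in>{1..p} - T. \<alpha> k (z k)) / real (exp_fact p d \<alpha>))"
    using z by (intro sum_raise_exponents') (auto simp: multi_indices_iff)
  also have "\<dots> \<le> (\<Sum>\<alpha>\<in>exponents p d (\<lambda>_. Suc m).
      real (Suc m) ^ card ({1..p} - T) * ((cmod (c \<alpha>))\<^sup>2 / real (exp_fact p d \<alpha>)))"
  proof (rule sum_mono)
    fix \<alpha> assume \<alpha>: "\<alpha> \<in> exponents p d (\<lambda>_. Suc m)"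
    have "(\<Prod>k\<in>{1..p} - T. \<alpha> k (z k)) \<le> (\<Prod>k\<in>{1..p} - T. Suc m)"
      using exponents_le[OF \<alpha>] by (intro prod_mono) auto
    then have "real (\<Prod>k\<in>{1..p} - T. \<alpha> k (z k)) \<le> real (Suc m) ^ card ({1..p} - T)"
      unfolding prod_constant by (simp only: of_nat_power[symmetric] of_nat_le_iff)
    then have "(cmod (c \<alpha>))\<^sup>2 / real (exp_fact p d \<alpha>) * real (\<Prod>k\<in>{1..p} - T. \<alpha> k (z k))
        \<le> (cmod (c \<alpha>))\<^sup>2 / real (exp_fact p d \<alpha>) * real (Suc m) ^ card ({1..p} - T)"
      by (rule mult_left_mono) simp
    then show "(cmod (c \<alpha>))\<^sup>2 * real (\<Prod>k\<in>{1..p} - T. \<alpha> k (z k)) / real (exp_fact p d \<alpha>)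
        \<le> real (Suc m) ^ card ({1..p} - T) * ((cmod (c \<alpha>))\<^sup>2 / real (exp_fact p d \<alpha>))"
      by (simp only: times_divide_eq_left times_divide_eq_right mult.commute)
  qed
  finally show ?thesis
    by (simp only: fock_norm_def sum_distrib_left)
qed

text \<open>
  \<open>u \<beta> x\<close> is the coefficient of the vector obtained by applying the creation operators of \<open>x\<close> in the
  factors in \<open>A\<close> and the annihilation operators in the others. Normal ordering of the Gram matrix \<open>G\<close>
  gives the partial transpose up to commutators, which occur only where \<open>x k = y k\<close>
  (the set \<open>T\<close>) and turn the factors \<open>\<gamma> k (x k)\<close> into \<open>Suc (\<gamma> k (x k))\<close>.
\<close>

lemma partial_transpose_reduced_mat_approx:
  assumes A: "A \<subseteq> {1..p}"
  obtains G where "pos_semidef (multi_indices p d) G"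
    and "\<And>x y. x \<in> multi_indices p d \<Longrightarrow> y \<in> multi_indices p d \<Longrightarrow>
      cmod (partial_transpose A (reduced_mat p d m c) x y - G x y)
        \<le> real p * real (m + 2) ^ (p - 1) * fock_norm p d (Suc m) c"
proof
  define Ac where "Ac = {1..p} - A"
  \<comment> \<open>From degree \<open>Suc m\<close>, a creation leads to \<open>m + 2\<close> on
    \<open>A\<close> and an annihilation to \<open>m\<close> on the other factors.\<close>
  define lA where "lA k = m + (if k \<in> A then 2 else 0)" for k
  \<comment> \<open>The truncated subtraction is harmless: if \<open>\<beta> k (x k) = 0\<close> for
    some \<open>k\<close> in \<open>A\<close>, the leading product vanishes.\<close>
  define u where "u \<beta> x = of_nat (\<Prod>k\<in>A. \<beta> k (x k)) * c (\<beta> + unit_exp Ac x - unit_exp A x)" for \<beta> x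
  define G where "G x y = (\<Sum>\<beta>\<in>exponents p d lA.
      complex_of_real (1 / real (exp_fact p d \<beta>)) * (u \<beta> x * cnj (u \<beta> y)))" for x y
  show "pos_semidef (multi_indices p d) G"
    by (rule pos_semidef_gram[of "exponents p d lA" "\<lambda>\<beta>. 1 / real (exp_fact p d \<beta>)" _ _ u])
      (simp_all add: G_def)
  fix x y assume x: "x \<in> multi_indices p d" and y: "y \<in> multi_indices p d"
  define T where "T = {k \<in> A. x k = y k}"
  define U where "U = A - T"
  define V where "V = {1..p} - T"
  define z where "z = override_on x y A"
  define z' where "z' = override_on y x A"
  have z: "z \<in> multi_indices p d" "z' \<in> multi_indices p d"
    using override_on_multi_indices_iff[OF A, of x y d] x y by (auto simp: z_def z'_def)
  have "finite A"
    using A by (rule finite_subset) simp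
  then have fin: "finite A" "finite T" "finite U"
    by (auto simp: T_def U_def)
  have sub: "T \<subseteq> {1..p}" "U \<subseteq> {1..p}" "V \<subseteq> {1..p}"
    using A by (auto simp: T_def U_def V_def)
  have xd: "x k < d k" "y k < d k" "z k < d k" if "k \<in> {1..p}" for k
    using x y z that by (simp_all add: multi_indices_iff)
  define H where "H \<gamma> = c (\<gamma> + unit_exp V z) * cnj (c (\<gamma> + unit_exp V z'))" for \<gamma>
  define lT where "lT k = m + (if k \<in> T then 1 else 0)" for k

  \<comment> \<open>Two substitutions, by \<open>unit_exp A x\<close> and then by
    \<open>unit_exp U y\<close>. On \<open>T\<close>, where \<open>x\<close> and \<open>y\<close>
    agree, the first one has already raised the occupation number, which produces the
    \<open>Suc\<close>.\<close>
  have G: "G x y = (\<Sum>\<gamma>\<in>exponents p d lT. of_nat (\<Prod>k\<in>T. Suc (\<gamma> k (x k))) * H \<gamma> / of_nat (exp_fact p d \<gamma>))"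
  proof -
    define F1 where "F1 \<beta> = c (\<beta> + unit_exp Ac x - unit_exp A x) * cnj (u \<beta> y)" for \<beta>
    define F2 where "F2 \<beta> = of_nat (\<Prod>k\<in>T. Suc (\<beta> k (x k))) * (c (\<beta> + unit_exp Ac x) *
        cnj (c (\<beta> + unit_exp A x + unit_exp Ac y - unit_exp A y)))" for \<beta>
    have "G x y = (\<Sum>\<beta>\<in>exponents p d lA. F1 \<beta> * of_nat (\<Prod>k\<in>A. \<beta> k (x k)) / of_nat (exp_fact p d \<beta>))"
      by (simp add: G_def F1_def u_def algebra_simps)
    also have "\<dots> = (\<Sum>\<beta>\<in>exponents p d (\<lambda>k. m + (if k \<in> A then 1 else 0)).
        F1 (\<beta> + unit_exp A x) / of_nat (exp_fact p d \<beta>))"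
      using A xd by (intro sum_raise_exponents'[symmetric]) (auto simp: lA_def)
    also have "\<dots> = (\<Sum>\<beta>\<in>exponents p d (\<lambda>k. m + (if k \<in> A then 1 else 0)).
        F2 \<beta> * of_nat (\<Prod>k\<in>U. \<beta> k (y k)) / of_nat (exp_fact p d \<beta>))"
    proof (rule sum.cong[OF refl])
      fix \<beta>
      have "(\<Prod>k\<in>A. (\<beta> + unit_exp A x) k (y k)) =
          (\<Prod>k\<in>T. (\<beta> + unit_exp A x) k (y k)) * (\<Prod>k\<in>U. (\<beta> + unit_exp A x) k (y k))"
        unfolding U_def using fin by (subst prod.subset_diff[of T A]) (auto simp: T_def mult.commute)
      also have "(\<Prod>k\<in>T. (\<beta> + unit_exp A x) k (y k)) = (\<Prod>k\<in>T. Suc (\<beta> k (x k)))"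
        by (intro prod.cong) (auto simp: T_def unit_exp_def)
      also have "(\<Prod>k\<in>U. (\<beta> + unit_exp A x) k (y k)) = (\<Prod>k\<in>U. \<beta> k (y k))"
        by (intro prod.cong) (auto simp: U_def T_def unit_exp_def)
      finally have P: "(\<Prod>k\<in>A. (\<beta> + unit_exp A x) k (y k)) =
          (\<Prod>k\<in>T. Suc (\<beta> k (x k))) * (\<Prod>k\<in>U. \<beta> k (y k))" .
      have E: "\<beta> + unit_exp A x + unit_exp Ac x - unit_exp A x = \<beta> + unit_exp Ac x"
        by (intro ext) simp
      show "F1 (\<beta> + unit_exp A x) / of_nat (exp_fact p d \<beta>) =
          F2 \<beta> * of_nat (\<Prod>k\<in>U. \<beta> k (y k)) / of_nat (exp_fact p d \<beta>)"
        unfolding F1_def F2_def u_def P E by (simp add: ac_simps del: of_nat_prod of_nat_Suc)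
    qed
    also have "\<dots> = (\<Sum>\<gamma>\<in>exponents p d lT. F2 (\<gamma> + unit_exp U y) / of_nat (exp_fact p d \<gamma>))"
      using xd sub by (intro sum_raise_exponents'[symmetric]) (auto simp: lT_def U_def T_def)
    also have "\<dots> = (\<Sum>\<gamma>\<in>exponents p d lT.
        of_nat (\<Prod>k\<in>T. Suc (\<gamma> k (x k))) * H \<gamma> / of_nat (exp_fact p d \<gamma>))"
    proof (rule sum.cong[OF refl])
      fix \<gamma>
      have P: "(\<Prod>k\<in>T. Suc ((\<gamma> + unit_exp U y) k (x k))) = (\<Prod>k\<in>T. Suc (\<gamma> k (x k)))"
        by (intro prod.cong) (auto simp: U_def unit_exp_def)
      have E1: "\<gamma> + unit_exp U y + unit_exp Ac x = \<gamma> + unit_exp V z"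
        using A by (intro ext) (auto simp: unit_exp_def Ac_def U_def V_def T_def z_def override_on_def)
      have E2: "\<gamma> + unit_exp U y + unit_exp A x + unit_exp Ac y - unit_exp A y = \<gamma> + unit_exp V z'"
        using A by (intro ext) (auto simp: unit_exp_def Ac_def U_def V_def T_def z'_def override_on_def)
      show "F2 (\<gamma> + unit_exp U y) / of_nat (exp_fact p d \<gamma>) =
          of_nat (\<Prod>k\<in>T. Suc (\<gamma> k (x k))) * H \<gamma> / of_nat (exp_fact p d \<gamma>)"
        unfolding F2_def H_def P E1 E2 by (rule refl)
    qed
    finally show ?thesis .
  qed

  \<comment> \<open>On \<open>T\<close> both \<open>z\<close> and \<open>z'\<close> agree with
    \<open>x\<close>; shifting that part off gives the same sum with \<open>\<gamma> k (x k)\<close>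
    in place of its successor.\<close>
  have R: "partial_transpose A (reduced_mat p d m c) x y =
      (\<Sum>\<gamma>\<in>exponents p d lT. of_nat (\<Prod>k\<in>T. \<gamma> k (x k)) * H \<gamma> / of_nat (exp_fact p d \<gamma>))"
  proof -
    have E: "unit_exp {1..p} w = unit_exp T x + unit_exp V w" if "\<And>k. k \<in> T \<Longrightarrow> w k = x k" for w
      using sub that by (intro ext) (auto simp: unit_exp_def V_def)
    have E: "unit_exp {1..p} z = unit_exp T x + unit_exp V z"
        "unit_exp {1..p} z' = unit_exp T x + unit_exp V z'"
      by (rule E, simp add: T_def z_def z'_def override_on_def)+
    have "partial_transpose A (reduced_mat p d m c) x y = 
        (\<Sum>\<gamma>\<in>exponents p d (\<lambda>_. m). H (\<gamma> + unit_exp T x) / of_nat (exp_fact p d \<gamma>))"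
      using z by (simp only: partial_transpose_def z_def[symmetric] z'_def[symmetric]
          reduced_mat_def E H_def add.assoc simp_thms if_True)
    also have "\<dots> = (\<Sum>\<gamma>\<in>exponents p d lT. H \<gamma> * of_nat (\<Prod>k\<in>T. \<gamma> k (x k)) / of_nat (exp_fact p d \<gamma>))"
      using xd sub by (intro sum_raise_exponents') (auto simp: lT_def)
    finally show ?thesis by (simp only: mult.commute)
  qed

  define \<delta> where "\<delta> = real (card T * (m + 2) ^ (card T - 1))"
  define N where "N = fock_norm p d (Suc m) c"
  have N: "0 \<le> N"
    by (auto simp: N_def fock_norm_def intro!: sum_nonneg)
  have \<delta>: "0 \<le> \<delta>" by (simp add: \<delta>_def)
  define q where "q w \<gamma> = (cmod (c (\<gamma> + unit_exp V w)))\<^sup>2 / real (exp_fact p d \<gamma>)" for w \<gamma>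
  \<comment> \<open>The sums differ only by a factor bounded by \<open>\<delta>\<close>, and
    \<open>a * b \<le> (a\<^sup>2 + b\<^sup>2) / 2\<close> reduces \<open>H\<close> to squared norms
    of lowered vectors.\<close>
  have "cmod (partial_transpose A (reduced_mat p d m c) x y - G x y) \<le>
      (\<Sum>\<gamma>\<in>exponents p d lT. \<delta> * ((q z \<gamma> + q z' \<gamma>) / 2))"
    unfolding R G sum_subtractf[symmetric]
  proof (rule sum_norm_le)
    fix \<gamma> assume \<gamma>: "\<gamma> \<in> exponents p d lT"
    define P where "P = (\<Prod>k\<in>T. \<gamma> k (x k))"
    define P' where "P' = (\<Prod>k\<in>T. Suc (\<gamma> k (x k)))"
    have "Suc (\<gamma> k (x k)) \<le> m + 2" if "k \<in> T" for k
      using exponents_le[OF \<gamma>, of k "x k"] sub(1) that by (auto simp: lT_def)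
    then have "P' \<le> P + card T * (m + 2) ^ (card T - 1)"
      unfolding P_def P'_def by (rule prod_Suc_le[OF fin(2)])
    then have "real P' \<le> real (P + card T * (m + 2) ^ (card T - 1))"
      by (simp only: of_nat_le_iff)
    moreover have "P \<le> P'"
      unfolding P_def P'_def by (intro prod_mono) auto
    ultimately have PP: "\<bar>real P - real P'\<bar> \<le> \<delta>"
      unfolding \<delta>_def by simp
    define a where "a = cmod (c (\<gamma> + unit_exp V z))"
    define b where "b = cmod (c (\<gamma> + unit_exp V z'))"
    have "of_nat P * H \<gamma> / of_nat (exp_fact p d \<gamma>) - of_nat P' * H \<gamma> / of_nat (exp_fact p d \<gamma>)
        = complex_of_real (real P - real P') * (H \<gamma> / of_nat (exp_fact p d \<gamma>))"
      by (simp add: algebra_simps diff_divide_distrib)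
    then have "cmod (of_nat P * H \<gamma> / of_nat (exp_fact p d \<gamma>) - of_nat P' * H \<gamma> / of_nat (exp_fact p d \<gamma>))
        = \<bar>real P - real P'\<bar> * (a * b / real (exp_fact p d \<gamma>))"
      by (simp only: norm_mult norm_divide norm_of_real norm_of_nat H_def complex_mod_cnj a_def b_def)
    also have "\<dots> \<le> \<delta> * (((a\<^sup>2 + b\<^sup>2) / 2) / real (exp_fact p d \<gamma>))"
    proof (intro mult_mono PP divide_right_mono)
      show "a * b \<le> (a\<^sup>2 + b\<^sup>2) / 2"
        using sum_squares_bound[of a b] by simp
    qed (auto simp: a_def b_def \<delta>_def)
    also have "\<dots> = \<delta> * ((q z \<gamma> + q z' \<gamma>) / 2)"
      by (simp add: q_def a_def b_def add_divide_distrib)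
    finally show "cmod (of_nat (\<Prod>k\<in>T. \<gamma> k (x k)) * H \<gamma> / of_nat (exp_fact p d \<gamma>) -
        of_nat (\<Prod>k\<in>T. Suc (\<gamma> k (x k))) * H \<gamma> / of_nat (exp_fact p d \<gamma>)) \<le> \<delta> * ((q z \<gamma> + q z' \<gamma>) / 2)"
      unfolding P_def P'_def .
  qed
  also have "\<dots> = \<delta> * (((\<Sum>\<gamma>\<in>exponents p d lT. q z \<gamma>) + (\<Sum>\<gamma>\<in>exponents p d lT. q z' \<gamma>)) / 2)"
    by (simp only: sum_distrib_left[symmetric] sum_divide_distrib[symmetric] sum.distrib)
  also have "\<dots> \<le> \<delta> * ((real (Suc m) ^ card V * N + real (Suc m) ^ card V * N) / 2)"
    unfolding q_def V_def N_def lT_def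
    by (intro mult_left_mono divide_right_mono add_mono sum_lowered_le_fock_norm sub z \<delta>) simp
  also have "\<dots> = real (card T) * (real (m + 2) ^ (card T - 1) * real (Suc m) ^ card V) * N"
    by (simp add: \<delta>_def)
  \<comment> \<open>For nonempty \<open>T\<close> the exponents \<open>card T - 1\<close> and
    \<open>p - card T\<close> add up to \<open>p - 1\<close>; for empty \<open>T\<close> the left
    side is zero.\<close>
  also have "\<dots> \<le> real p * real (m + 2) ^ (p - 1) * N"
  proof (cases "T = {}")
    case False
    have cardV: "card V = p - card T"
      unfolding V_def using sub(1) fin(2) by (simp add: card_Diff_subset)
    have cardT: "card T \<le> p" "0 < card T"
      using card_mono[OF _ sub(1)] False fin(2) by (auto simp: card_gt_0_iff)
    have "real (m + 2) ^ (card T - 1) * real (Suc m) ^ card V \<le>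
        real (m + 2) ^ (card T - 1) * real (m + 2) ^ card V"
      by (intro mult_left_mono power_mono) auto
    also have "\<dots> = real (m + 2) ^ (p - 1)"
      using cardV cardT by (simp add: power_add[symmetric])
    finally show ?thesis
      using cardT N by (intro mult_right_mono mult_mono) auto
  qed (use N in simp)
  finally show "cmod (partial_transpose A (reduced_mat p d m c) x y - G x y)
      \<le> real p * real (m + 2) ^ (p - 1) * fock_norm p d (Suc m) c"
    unfolding N_def .
qed

text \<open>The bound is the trace, so after normalization all entries have modulus at most one, as
  the compactness argument requires.\<close>

lemma cmod_reduced_mat_le:
  "cmod (reduced_mat p d m c x y) \<le> real (Suc m) ^ p * fock_norm p d (Suc m) c"
proof (cases "x \<in> multi_indices p d \<and> y \<in> multi_indices p d")
  case True
  define q where "q w \<gamma> = (cmod (c (\<gamma> + unit_exp {1..p} w)))\<^sup>2 / real (exp_fact p d \<gamma>)" for w \<gamma>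
  have q: "(\<Sum>\<gamma>\<in>exponents p d (\<lambda>_. m). q w \<gamma>) \<le> real (Suc m) ^ p * fock_norm p d (Suc m) c"
    if "w \<in> multi_indices p d" for w
    using sum_lowered_le_fock_norm[of "{}" p w d c m] that by (simp add: q_def)
  have "cmod (reduced_mat p d m c x y) \<le> (\<Sum>\<gamma>\<in>exponents p d (\<lambda>_. m). (q x \<gamma> + q y \<gamma>) / 2)"
    unfolding reduced_mat_def if_P[OF True]
  proof (rule sum_norm_le)
    fix \<gamma>
    define a where "a = cmod (c (\<gamma> + unit_exp {1..p} x))"
    define b where "b = cmod (c (\<gamma> + unit_exp {1..p} y))"
    have "cmod (c (\<gamma> + unit_exp {1..p} x) * cnj (c (\<gamma> + unit_exp {1..p} y)) / of_nat (exp_fact p d \<gamma>))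
        = a * b / real (exp_fact p d \<gamma>)"
      by (simp only: norm_mult norm_divide norm_of_nat complex_mod_cnj a_def b_def)
    also have "\<dots> \<le> ((a\<^sup>2 + b\<^sup>2) / 2) / real (exp_fact p d \<gamma>)"
      using sum_squares_bound[of a b] by (intro divide_right_mono) auto
    also have "\<dots> = (q x \<gamma> + q y \<gamma>) / 2"
      by (simp add: q_def a_def b_def add_divide_distrib)
    finally show "cmod (c (\<gamma> + unit_exp {1..p} x) * cnj (c (\<gamma> + unit_exp {1..p} y)) / of_nat (exp_fact p d \<gamma>))
        \<le> (q x \<gamma> + q y \<gamma>) / 2" .
  qed
  also have "\<dots> = ((\<Sum>\<gamma>\<in>exponents p d (\<lambda>_. m). q x \<gamma>) + (\<Sum>\<gamma>\<in>exponents p d (\<lambda>_. m). q y \<gamma>)) / 2"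
    by (simp only: sum_divide_distrib[symmetric] sum.distrib)
  also have "\<dots> \<le> real (Suc m) ^ p * fock_norm p d (Suc m) c"
    using q[of x] q[of y] True by simp
  finally show ?thesis .
next
  case False
  have "0 \<le> fock_norm p d (Suc m) c"
    by (auto simp: fock_norm_def intro!: sum_nonneg)
  then show ?thesis
    unfolding reduced_mat_def if_not_P[OF False] by simp
qed

subsection \<open>Limits of matrices\<close>

text \<open>Bolzano-Weierstrass for one coordinate after the other, refining the subsequence each
  time.\<close>

lemma bounded_family_convergent_subsequence:
  fixes f :: "nat \<Rightarrow> 'a \<Rightarrow> complex"
  assumes "finite J" "\<And>m j. j \<in> J \<Longrightarrow> cmod (f m j) \<le> C"
  shows "\<exists>r g. strict_mono (r :: nat \<Rightarrow> nat) \<and> (\<forall>j\<in>J. (\<lambda>m. f (r m) j) \<longlonglongrightarrow> g j)"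
  using assms
proof (induction J rule: finite_induct)
  case empty
  then show ?case using strict_mono_id by blast
next
  case (insert a J)
  then obtain r g where r: "strict_mono r" and g: "\<And>j. j \<in> J \<Longrightarrow> (\<lambda>m. f (r m) j) \<longlonglongrightarrow> g j"
    by (metis insertCI)
  have "seq_compact (cball (0::complex) C)"
    using compact_cball compact_imp_seq_compact by blast
  moreover have "\<forall>m. f (r m) a \<in> cball 0 C"
    using insert.prems by simp
  ultimately obtain l s where s: "strict_mono s" and l: "((\<lambda>m. f (r m) a) \<circ> s) \<longlonglongrightarrow> l"
    by (rule seq_compactE)
  have "(\<lambda>m. f ((r \<circ> s) m) j) \<longlonglongrightarrow> (g(a := l)) j" if "j \<in> insert a J" for j
  proof (cases "j = a")
    case True
    then show ?thesis using l by (simp add: o_def)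
  next
    case False
    then have "((\<lambda>m. f (r m) j) \<circ> s) \<longlonglongrightarrow> g j"
      using that s by (intro LIMSEQ_subseq_LIMSEQ[OF g]) auto
    then show ?thesis using False by (simp add: o_def)
  qed
  then show ?case
    using strict_mono_o[OF r s] by blast
qed

lemma pos_semidef_limit:
  assumes G: "\<And>m. pos_semidef I (G m)"
    and lim: "\<And>x y. x \<in> I \<Longrightarrow> y \<in> I \<Longrightarrow> (\<lambda>m. G m x y) \<longlonglongrightarrow> M x y"
  shows "pos_semidef I M"
  unfolding pos_semidef_def
proof (intro conjI ballI)
  show "hermitian I M"
    unfolding hermitian_def
  proof (intro ballI)
    fix x y assume xy: "x \<in> I" "y \<in> I"
    have "G m x y = cnj (G m y x)" for m
      using G[of m] xy unfolding pos_semidef_def hermitian_def by blast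
    then have "(\<lambda>m. G m x y) \<longlonglongrightarrow> cnj (M y x)"
      using tendsto_cnj[OF lim[OF xy(2,1)]] by simp
    then show "M x y = cnj (M y x)"
      using lim[OF xy] LIMSEQ_unique by blast
  qed
  fix v assume v: "v \<in> vecs I"
  have "(\<lambda>m. Re (\<Sum>x\<in>I. cnj (v x) * mat_vec I (G m) v x)) \<longlonglongrightarrow> Re (\<Sum>x\<in>I. cnj (v x) * mat_vec I M v x)"
    unfolding mat_vec_def by (intro tendsto_intros lim)
  then show "0 \<le> Re (\<Sum>x\<in>I. cnj (v x) * mat_vec I M v x)"
    by (rule LIMSEQ_le_const) (use G v in \<open>auto simp: pos_semidef_def\<close>)
qed

lemma pos_semidef_scale:
  assumes "pos_semidef I M" "0 \<le> a"
  shows "pos_semidef I (\<lambda>x y. complex_of_real a * M x y)"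
proof -
  have "(\<Sum>x\<in>I. cnj (v x) * mat_vec I (\<lambda>x y. complex_of_real a * M x y) v x) =
      complex_of_real a * (\<Sum>x\<in>I. cnj (v x) * mat_vec I M v x)" for v
    by (simp add: mat_vec_def sum_distrib_left ac_simps)
  moreover have "hermitian I (\<lambda>x y. complex_of_real a * M x y)"
    using assms(1) unfolding pos_semidef_def hermitian_def
    by (metis complex_cnj_complex_of_real complex_cnj_mult)
  ultimately show ?thesis
    using assms by (simp add: pos_semidef_def)
qed

subsection \<open>The upper bound\<close>

lemma ppt_state_exists:
  assumes p: "0 < p" and d: "\<And>k. k \<in> {1..p} \<Longrightarrow> 0 < d k"
    and F: "finite F" "card F \<le> (\<Sum>k\<in>{1..p}. d k - 1)"
  obtains \<rho> where "density_matrix (multi_indices p d) \<rho>"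
    and "\<And>f y. f \<in> F \<Longrightarrow> (\<Sum>x\<in>multi_indices p d. f x * \<rho> x y) = 0"
    and "\<And>A. A \<subseteq> {1..p} \<Longrightarrow> pos_semidef (multi_indices p d) (partial_transpose A \<rho>)"
proof -
  let ?I = "multi_indices p d"
  have "\<exists>c. c \<in> vecs (exponents p d (\<lambda>_. Suc m)) \<and> c \<noteq> 0 \<and> (\<forall>f\<in>F. contract p d f c = 0)" for m
    using contract_kernel_nontrivial[of p d F "Suc m", OF d F] by metis
  then obtain c where c: "\<And>m. c m \<in> vecs (exponents p d (\<lambda>_. Suc m))" "\<And>m. c m \<noteq> 0"
      "\<And>m f. f \<in> F \<Longrightarrow> contract p d f (c m) = 0"
    by metis
  define N where "N m = fock_norm p d (Suc m) (c m)" for m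
  have N: "0 < N m" for m
    unfolding N_def by (rule fock_norm_pos[OF c(1,2)])
  \<comment> \<open>The reciprocal of the trace of the reduced matrix.\<close>
  define a where "a m = 1 / (real (Suc m) ^ p * N m)" for m
  have a: "0 < a m" for m
    using N[of m] by (simp add: a_def)
  define R where "R m = (\<lambda>x y. complex_of_real (a m) * reduced_mat p d m (c m) x y)" for m
  have R_psd: "pos_semidef ?I (R m)" for m
    unfolding R_def using a[of m] by (intro pos_semidef_scale pos_semidef_reduced_mat) simp
  have R_bound: "cmod (R m x y) \<le> 1" for m x y
  proof -
    have "cmod (R m x y) = a m * cmod (reduced_mat p d m (c m) x y)"
      using a[of m] by (simp add: R_def norm_mult)
    also have "\<dots> \<le> a m * (real (Suc m) ^ p * N m)"
      unfolding N_def using a[of m] by (intro mult_left_mono cmod_reduced_mat_le) simp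
    also have "\<dots> = 1"
      using N[of m] by (simp add: a_def)
    finally show ?thesis .
  qed
  have R_trace: "mat_trace ?I (R m) = 1" for m
  proof -
    have "mat_trace ?I (R m) = complex_of_real (a m) * mat_trace ?I (reduced_mat p d m (c m))"
      by (simp add: mat_trace_def R_def sum_distrib_left)
    also have "\<dots> = complex_of_real (a m * (real (Suc m) ^ p * N m))"
      by (simp only: mat_trace_reduced_mat N_def of_real_mult)
    also have "a m * (real (Suc m) ^ p * N m) = 1"
      using N[of m] by (simp add: a_def)
    finally show ?thesis by simp
  qed
  have R_ann: "(\<Sum>x\<in>?I. f x * R m x y) = 0" if "f \<in> F" for f m y
  proof -
    have "(\<Sum>x\<in>?I. f x * R m x y) =
        complex_of_real (a m) * (\<Sum>x\<in>?I. f x * reduced_mat p d m (c m) x y)"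
      by (simp add: R_def sum_distrib_left ac_simps)
    then show ?thesis
      by (simp only: contract_reduced_mat[OF c(3)[OF that]] mult_zero_right)
  qed
  obtain r g where r: "strict_mono (r :: nat \<Rightarrow> nat)"
    and g: "\<And>z. z \<in> ?I \<times> ?I \<Longrightarrow> (\<lambda>m. R (r m) (fst z) (snd z)) \<longlonglongrightarrow> g z"
    using bounded_family_convergent_subsequence[of "?I \<times> ?I" "\<lambda>m z. R m (fst z) (snd z)" 1]
      finite_multi_indices R_bound by (metis finite_cartesian_product)
  define \<rho> where "\<rho> = (\<lambda>x y. if x \<in> ?I \<and> y \<in> ?I then g (x, y) else 0)"
  have lim: "(\<lambda>m. R (r m) x y) \<longlonglongrightarrow> \<rho> x y" for x y
  proof (cases "x \<in> ?I \<and> y \<in> ?I")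
    case True
    then show ?thesis using g[of "(x, y)"] by (simp add: \<rho>_def)
  next
    case False
    then have "R m x y = 0" "\<rho> x y = 0" for m
      by (auto simp: R_def reduced_mat_def \<rho>_def)
    then show ?thesis by simp
  qed
  show ?thesis
  proof
    have "(\<lambda>m. mat_trace ?I (R (r m))) \<longlonglongrightarrow> mat_trace ?I \<rho>"
      unfolding mat_trace_def by (intro tendsto_sum lim)
    then have "mat_trace ?I \<rho> = 1"
      by (simp add: R_trace LIMSEQ_const_iff)
    moreover have "pos_semidef ?I \<rho>"
      by (rule pos_semidef_limit[OF R_psd lim])
    moreover have "\<rho> \<in> mats ?I"
      by (auto simp: mats_def \<rho>_def)
    ultimately show "density_matrix ?I \<rho>"
      by (simp add: density_matrix_def)
    show "(\<Sum>x\<in>?I. f x * \<rho> x y) = 0" if "f \<in> F" for f y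
    proof -
      have "(\<lambda>m. \<Sum>x\<in>?I. f x * R (r m) x y) \<longlonglongrightarrow> (\<Sum>x\<in>?I. f x * \<rho> x y)"
        by (intro tendsto_intros lim)
      then show ?thesis
        by (simp add: R_ann[OF that] LIMSEQ_const_iff)
    qed
    fix A assume A: "A \<subseteq> {1..p}"
    have "\<exists>G. pos_semidef ?I G \<and> (\<forall>x\<in>?I. \<forall>y\<in>?I.
        cmod (partial_transpose A (reduced_mat p d m (c m)) x y - G x y)
          \<le> real p * real (m + 2) ^ (p - 1) * N m)" for m
      unfolding N_def using partial_transpose_reduced_mat_approx[OF A, of d m "c m"] by metis
    then obtain G where G: "\<And>m. pos_semidef ?I (G m)"
      and G_approx: "\<And>m x y. x \<in> ?I \<Longrightarrow> y \<in> ?I \<Longrightarrow>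
        cmod (partial_transpose A (reduced_mat p d m (c m)) x y - G m x y)
          \<le> real p * real (m + 2) ^ (p - 1) * N m"
      by metis
    \<comment> \<open>The estimate \<open>m + 2 \<le> 2 * Suc m\<close> costs the factor
      \<open>2 ^ (p - 1)\<close>; division by \<open>Suc m ^ p\<close> then leaves one
      \<open>Suc m\<close> in the denominator.\<close>
    define K where "K = real p * 2 ^ (p - 1)"
    have close: "cmod (partial_transpose A (R m) x y - complex_of_real (a m) * G m x y) \<le> K / real (Suc m)"
      if "x \<in> ?I" "y \<in> ?I" for m x y
    proof -
      have "partial_transpose A (R m) x y - complex_of_real (a m) * G m x y =
          complex_of_real (a m) * (partial_transpose A (reduced_mat p d m (c m)) x y - G m x y)"
        by (simp add: partial_transpose_def R_def right_diff_distrib)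
      then have "cmod (partial_transpose A (R m) x y - complex_of_real (a m) * G m x y) =
          a m * cmod (partial_transpose A (reduced_mat p d m (c m)) x y - G m x y)"
        using a[of m] by (simp add: norm_mult)
      also have "\<dots> \<le> a m * (real p * real (m + 2) ^ (p - 1) * N m)"
        using a[of m] by (intro mult_left_mono G_approx that) simp
      also have "\<dots> \<le> a m * (real p * (2 * real (Suc m)) ^ (p - 1) * N m)"
        using a[of m] N[of m] by (intro mult_left_mono mult_right_mono power_mono) auto
      also have "\<dots> = K / real (Suc m)"
      proof -
        have "real (Suc m) ^ p = real (Suc m) * real (Suc m) ^ (p - 1)"
          using p by (metis Suc_diff_1 power_Suc)
        then show ?thesis
          using N[of m] by (simp add: a_def K_def power_mult_distrib field_simps del: of_nat_Suc)
      qed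
      finally show ?thesis .
    qed
    show "pos_semidef ?I (partial_transpose A \<rho>)"
    proof (rule pos_semidef_limit)
      show "pos_semidef ?I (\<lambda>x y. complex_of_real (a (r m)) * G (r m) x y)" for m
        using a[of "r m"] by (intro pos_semidef_scale G) simp
      fix x y assume xy: "x \<in> ?I" "y \<in> ?I"
      have "(\<lambda>m. K / real (Suc m)) \<longlonglongrightarrow> 0"
        by (rule LIMSEQ_Suc[OF lim_const_over_n])
      then have "(\<lambda>m. K / real (Suc (r m))) \<longlonglongrightarrow> 0"
        using LIMSEQ_subseq_LIMSEQ[OF _ r] by (force simp: o_def)
      then have "(\<lambda>m. partial_transpose A (R (r m)) x y - complex_of_real (a (r m)) * G (r m) x y) \<longlonglongrightarrow> 0"
        by (rule Lim_null_comparison[rotated]) (use close xy in simp)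
      moreover have "(\<lambda>m. partial_transpose A (R (r m)) x y) \<longlonglongrightarrow> partial_transpose A \<rho> x y"
        unfolding partial_transpose_def by (rule lim)
      ultimately show "(\<lambda>m. complex_of_real (a (r m)) * G (r m) x y) \<longlonglongrightarrow> partial_transpose A \<rho> x y"
        using tendsto_diff by fastforce
    qed
  qed
qed

text \<open>Otherwise few enough linear forms cut out \<open>S\<close> for
  \<open>ppt_state_exists\<close> to apply, and the state annihilated by them has its support in
  \<open>S\<close>.\<close>

lemma dim_npt_subspace_le:
  assumes p: "0 < p" and d: "\<And>k. k \<in> {1..p} \<Longrightarrow> 0 < d k" and S: "npt_subspace p d S"
  shows "cvec.dim S + (\<Sum>k\<in>{1..p}. d k - 1) < card (multi_indices p d)"
proof (rule ccontr)
  let ?I = "multi_indices p d"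
  assume large: "\<not> ?thesis"
  have S': "cvec.subspace S" "S \<subseteq> vecs ?I"
    using S by (auto simp: npt_subspace_def)
  obtain F where F: "finite F" "card F + cvec.dim S \<le> card ?I"
    and ann: "\<And>v. v \<in> vecs ?I \<Longrightarrow> (\<And>f. f \<in> F \<Longrightarrow> (\<Sum>x\<in>?I. f x * v x) = 0) \<Longrightarrow> v \<in> S"
    using annihilator_exists[OF finite_multi_indices S'] by blast
  have "card F \<le> (\<Sum>k\<in>{1..p}. d k - 1)"
    using F(2) large by linarith
  then obtain \<rho> where \<rho>: "density_matrix ?I \<rho>"
      "\<And>f y. f \<in> F \<Longrightarrow> (\<Sum>x\<in>?I. f x * \<rho> x y) = 0"
      "\<And>A. A \<subseteq> {1..p} \<Longrightarrow> pos_semidef ?I (partial_transpose A \<rho>)"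
    using ppt_state_exists[of p d F, OF p d F(1)] by blast
  have "supp ?I \<rho> \<subseteq> S"
    unfolding supp_def
  proof (rule image_subsetI, rule ann)
    fix v assume "v \<in> vecs ?I"
    show "mat_vec ?I \<rho> v \<in> vecs ?I"
      using \<rho>(1) by (auto simp: density_matrix_def mats_def vecs_def mat_vec_def)
    fix f assume f: "f \<in> F"
    have "(\<Sum>x\<in>?I. f x * mat_vec ?I \<rho> v x) = (\<Sum>x\<in>?I. \<Sum>y\<in>?I. f x * \<rho> x y * v y)"
      by (simp only: mat_vec_def sum_distrib_left mult.assoc)
    also have "\<dots> = (\<Sum>y\<in>?I. \<Sum>x\<in>?I. f x * \<rho> x y * v y)"
      by (rule sum.swap)
    also have "\<dots> = (\<Sum>y\<in>?I. (\<Sum>x\<in>?I. f x * \<rho> x y) * v y)"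
      by (simp only: sum_distrib_right)
    also have "\<dots> = 0"
      by (simp only: \<rho>(2)[OF f] mult_zero_left sum.neutral_const)
    finally show "(\<Sum>x\<in>?I. f x * mat_vec ?I \<rho> v x) = 0" .
  qed
  then show False
    using S \<rho>(1,3) unfolding npt_subspace_def by blast
qed

subsection \<open>A subspace attaining the bound\<close>

text \<open>On the vector with entries \<open>- s * M x y\<close> at \<open>x\<close> and 1 at
  \<open>y\<close>, the quadratic form is affine in the real number \<open>s\<close> with slope
  \<open>- 2 * (cmod (M x y))\<^sup>2\<close>, so nonnegativity forces the slope to vanish.\<close>

lemma pos_semidef_zero_diagonal:
  assumes M: "pos_semidef I M" and I: "finite I" "x \<in> I" "y \<in> I" and 0: "M x x = 0"
  shows "M x y = 0"
proof (cases "x = y")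
  case False
  define b where "b = M x y"
  have yx: "M y x = cnj b"
    using M I unfolding pos_semidef_def hermitian_def b_def by blast
  have quad: "0 \<le> Re (M y y) - 2 * s * (cmod b)\<^sup>2" for s :: real
  proof -
    define t where "t = - complex_of_real s * b"
    define v where "v = (\<lambda>z. if z = x then t else if z = y then 1 else 0)"
    have v: "v \<in> vecs I"
      using I by (auto simp: v_def vecs_def)
    have two: "(\<Sum>z\<in>I. h z) = h x + h y" if "\<And>z. z \<noteq> x \<Longrightarrow> z \<noteq> y \<Longrightarrow> h z = 0" for h :: "_ \<Rightarrow> complex"
    proof -
      have "(\<Sum>z\<in>I. h z) = (\<Sum>z\<in>{x, y}. h z)"
        using I that by (intro sum.mono_neutral_right) auto
      then show ?thesis using False by simp
    qed
    have Mv: "mat_vec I M v z = M z x * t + M z y" for z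
      unfolding mat_vec_def using False by (subst two) (auto simp: v_def)
    have "(\<Sum>z\<in>I. cnj (v z) * mat_vec I M v z) = cnj t * (M x x * t + M x y) + (M y x * t + M y y)"
      unfolding Mv using False by (subst two) (auto simp: v_def)
    also have "\<dots> = M y y - 2 * complex_of_real s * (b * cnj b)"
      by (simp add: 0 yx t_def b_def algebra_simps)
    also have "Re \<dots> = Re (M y y) - 2 * s * (cmod b)\<^sup>2"
      unfolding complex_norm_square[symmetric] by simp
    finally show ?thesis
      using M v unfolding pos_semidef_def by metis
  qed
  have "b = 0"
  proof (rule ccontr)
    assume "b \<noteq> 0"
    then have "0 < (cmod b)\<^sup>2" by simp
    \<comment> \<open>For this value of \<open>s\<close> the form would be -1.\<close>
    then have "2 * ((Re (M y y) + 1) / (2 * (cmod b)\<^sup>2)) * (cmod b)\<^sup>2 = Re (M y y) + 1"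
      by (simp add: field_simps)
    then show False
      using quad[of "(Re (M y y) + 1) / (2 * (cmod b)\<^sup>2)"] by linarith
  qed
  then show ?thesis by (simp add: b_def)
qed (use 0 in simp)

section \<open>The grading by coordinate sums and the balanced subspace\<close>

definition weight :: "nat \<Rightarrow> (nat \<Rightarrow> nat) \<Rightarrow> nat" where
  "weight p x = (\<Sum>k\<in>{1..p}. x k)"

definition weight_sum :: "nat \<Rightarrow> (nat \<Rightarrow> nat) \<Rightarrow> ((nat \<Rightarrow> nat) \<Rightarrow> complex) \<Rightarrow> nat \<Rightarrow> complex" where
  "weight_sum p d v = (\<lambda>w. \<Sum>x | x \<in> multi_indices p d \<and> weight p x = w. v x)"

definition balanced_subspace :: "nat \<Rightarrow> (nat \<Rightarrow> nat) \<Rightarrow> ((nat \<Rightarrow> nat) \<Rightarrow> complex) set" where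
  "balanced_subspace p d = {v \<in> vecs (multi_indices p d). weight_sum p d v = 0}"

lemma linear_weight_sum: "Vector_Spaces.linear cscale cscale (weight_sum p d)"
  unfolding linear_cscale_iff weight_sum_def cscale_def
  by (auto simp: fun_eq_iff sum.distrib sum_distrib_left)

lemma weight_le:
  assumes "x \<in> multi_indices p d"
  shows "weight p x \<le> (\<Sum>k\<in>{1..p}. d k - 1)"
  unfolding weight_def
proof (rule sum_mono)
  fix k assume "k \<in> {1..p}"
  then have "x k < d k" using assms by (simp add: multi_indices_iff)
  then show "x k \<le> d k - 1" by simp
qed

text \<open>The weights lie between \<open>0\<close> and \<open>n\<close>, so the subspace is the
  kernel of a linear map into a space of dimension \<open>n + 1\<close>.\<close>

lemma dim_balanced_subspace_ge:
  "card (multi_indices p d) \<le> cvec.dim (balanced_subspace p d) + (\<Sum>k\<in>{1..p}. d k - 1) + 1"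
proof -
  define n where "n = (\<Sum>k\<in>{1..p}. d k - 1)"
  let ?V = "vecs (multi_indices p d)"
  have range: "weight_sum p d ` ?V \<subseteq> vecs {..n}"
  proof (rule image_subsetI)
    fix v
    have "weight_sum p d v w = 0" if "w \<notin> {..n}" for w
    proof -
      have none: "\<not> (x \<in> multi_indices p d \<and> weight p x = w)" for x
        using weight_le[of x p d] that by (auto simp: n_def)
      show ?thesis
        unfolding weight_sum_def by (simp only: none simp_thms Collect_const if_False sum.empty)
    qed
    then show "weight_sum p d v \<in> vecs {..n}"
      by (simp add: vecs_def)
  qed
  have "cvec.dim ?V \<le> cvec.dim (balanced_subspace p d) + cvec.dim (weight_sum p d ` ?V)"
    unfolding balanced_subspace_def
    by (rule dim_le_kernel_plus_image[OF subspace_vecs subset_refl finite_multi_indices linear_weight_sum range])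
      simp
  also have "cvec.dim (weight_sum p d ` ?V) \<le> cvec.dim (vecs {..n})"
    by (rule dim_mono_vecs[OF _ range subset_refl]) simp
  finally show ?thesis
    using dim_vecs[OF finite_multi_indices, of p d] dim_vecs[of "{..n}"] by (simp add: n_def)
qed

lemma npt_balanced_subspace: "npt_subspace p d (balanced_subspace p d)"
  unfolding npt_subspace_def
proof (intro conjI allI impI)
  let ?I = "multi_indices p d"
  show "cvec.subspace (balanced_subspace p d)"
    unfolding balanced_subspace_def by (rule subspace_linear_kernel[OF subspace_vecs linear_weight_sum])
  show "balanced_subspace p d \<subseteq> vecs ?I"
    by (auto simp: balanced_subspace_def)
  fix \<rho> assume \<rho>: "density_matrix ?I \<rho> \<and> supp ?I \<rho> \<subseteq> balanced_subspace p d"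
  show "\<exists>A\<subseteq>{1..p}. \<not> pos_semidef ?I (partial_transpose A \<rho>)"
  proof (rule ccontr)
    assume "\<not> ?thesis"
    then have ppt: "pos_semidef ?I (partial_transpose A \<rho>)" if "A \<subseteq> {1..p}" for A
      using that by blast
    \<comment> \<open>The columns of \<open>\<rho>\<close> are images of coordinate vectors and
      hence lie in the support.\<close>
    have column: "(\<Sum>x | x \<in> ?I \<and> weight p x = w. \<rho> x y) = 0" if y: "y \<in> ?I" for w y
    proof -
      have "mat_vec ?I \<rho> (coord_vec y) = (\<lambda>x. \<rho> x y)"
        unfolding mat_vec_def coord_vec_def using y finite_multi_indices[of p d]
        by (simp add: if_distrib[of "(*) _"] cong: if_cong)
      then have "(\<lambda>x. \<rho> x y) \<in> balanced_subspace p d"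
        using \<rho> coord_vec_in_vecs[OF y] unfolding supp_def by (metis imageI subsetD)
      then have "weight_sum p d (\<lambda>x. \<rho> x y) w = 0"
        by (simp add: balanced_subspace_def)
      then show ?thesis by (simp add: weight_sum_def)
    qed
    have diag: "\<rho> x x = 0" if "x \<in> ?I" "weight p x = w" for x w
      using that
    proof (induction w arbitrary: x rule: less_induct)
      case (less w y)
      have off: "\<rho> x y = 0" if x: "x \<in> ?I" "weight p x = w" "x \<noteq> y" for x
      proof -
        define A where "A = {k \<in> {1..p}. y k < x k}"
        have A: "A \<subseteq> {1..p}" by (auto simp: A_def)
        \<comment> \<open>the componentwise minimum and maximum of \<open>x\<close> and \<open>y\<close>\<close>
        define lo where "lo = override_on x y A"
        define hi where "hi = override_on y x A"
        have I: "lo \<in> ?I" "hi \<in> ?I"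
          using override_on_multi_indices_iff[OF A, of x y d] x less.prems by (auto simp: lo_def hi_def)
        \<comment> \<open>If \<open>x\<close> were nowhere above \<open>y\<close>, then, the two
          being distinct, their weights would differ. So passing to the minimum strictly lowers the
          weight.\<close>
        have "A \<noteq> {}"
        proof
          assume "A = {}"
          then have le: "x k \<le> y k" if "k \<in> {1..p}" for k
            using that by (auto simp: A_def not_less)
          obtain k where k: "x k \<noteq> y k" using x(3) by blast
          then have "k \<in> {1..p}"
            using x(1) less.prems(1) by (metis multi_indices_iff)
          then have "\<exists>k\<in>{1..p}. x k < y k"
            using le k le_neq_implies_less by blast
          then have "weight p x < weight p y"
            unfolding weight_def using le by (intro sum_strict_mono_ex1) auto
          then show False using x(2) less.prems(2) by simp
        qed
        then have "weight p lo < weight p x"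
          unfolding weight_def by (intro sum_strict_mono_ex1) (auto simp: lo_def override_on_def A_def)
        then have "\<rho> lo lo = 0"
          using less.IH[of "weight p lo" lo] I x(2) by simp
        \<comment> \<open>Partial transposition fixes diagonal entries, so the induction hypothesis
          also kills the row of \<open>lo\<close> in the transposed matrix.\<close>
        then have "partial_transpose A \<rho> lo lo = 0"
          by (simp add: partial_transpose_def override_on_def)
        then have "partial_transpose A \<rho> lo hi = 0"
          by (rule pos_semidef_zero_diagonal[OF ppt[OF A] finite_multi_indices I])
        moreover have "override_on lo hi A = x" "override_on hi lo A = y"
          by (auto simp: lo_def hi_def override_on_def fun_eq_iff)
        ultimately show ?thesis by (simp add: partial_transpose_def)
      qed
      \<comment> \<open>The vanishing column sum thus reduces to its diagonal term.\<close>
      have "(\<Sum>x | x \<in> ?I \<and> weight p x = w. \<rho> x y) = (\<Sum>x\<in>{y}. \<rho> x y)"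
        using finite_multi_indices[of p d] less.prems off by (intro sum.mono_neutral_right) auto
      then show ?case
        using column[OF less.prems(1), of w] by simp
    qed
    then have "mat_trace ?I \<rho> = 0"
      by (simp add: mat_trace_def)
    then show False using \<rho> by (simp add: density_matrix_def)
  qed
qed

theorem mainTheorem9:
  fixes p :: nat and d :: "nat \<Rightarrow> nat"
  assumes "2 \<le> p"
    and "\<And>k. k \<in> {1..p} \<Longrightarrow> 0 < d k"
  shows "(\<exists>S. npt_subspace p d S \<and>
            int (cvec.dim S) = (\<Prod>k=1..p. int (d k)) - (\<Sum>k=1..p. int (d k)) + int p - 1) \<and>
         (\<forall>S. npt_subspace p d S \<longrightarrow>
            int (cvec.dim S) \<le> (\<Prod>k=1..p. int (d k)) - (\<Sum>k=1..p. int (d k)) + int p - 1)"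
proof -
  define n where "n = (\<Sum>k\<in>{1..p}. d k - 1)"
  \<comment> \<open>Positivity of \<open>d k\<close> turns the truncated \<open>d k - 1\<close> into
    an integer difference.\<close>
  have "int n = (\<Sum>k=1..p. int (d k) - 1)"
    unfolding n_def of_nat_sum using assms(2) by (intro sum.cong refl) (simp add: of_nat_diff Suc_leI)
  then have n: "int n = (\<Sum>k=1..p. int (d k)) - int p"
    by (simp add: sum_subtractf)
  have D: "int (card (multi_indices p d)) = (\<Prod>k=1..p. int (d k))"
    by (simp add: card_multi_indices)
  have upper: "cvec.dim S + n < card (multi_indices p d)" if "npt_subspace p d S" for S
    unfolding n_def by (rule dim_npt_subspace_le) (use assms that in auto)
  \<comment> \<open>The balanced subspace is itself NPT, so the general upper bound meets the lower
    bound for its dimension.\<close>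
  have "cvec.dim (balanced_subspace p d) + n + 1 = card (multi_indices p d)"
    using dim_balanced_subspace_ge[of p d] upper[OF npt_balanced_subspace] by (simp add: n_def)
  then have "int (cvec.dim (balanced_subspace p d)) = 
      (\<Prod>k=1..p. int (d k)) - (\<Sum>k=1..p. int (d k)) + int p - 1"
    using n D by linarith
  moreover have "int (cvec.dim S) \<le> (\<Prod>k=1..p. int (d k)) - (\<Sum>k=1..p. int (d k)) + int p - 1"
    if "npt_subspace p d S" for S
    using upper[OF that] n D by linarith
  ultimately show ?thesis
    using npt_balanced_subspace by blast
qed

end
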